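(* Let $A'$ and $A''$ be simple closed densely defined symmetric operators in separable Hilbert spaces $\mathfrak H'$ and $\mathfrak H''$, each with equal deficiency indices. Then $A'$ and $A''$ are unitarily equivalent if and only if, for some choice of boundary triplets $\{\mathcal H^1,\Gamma_0',\Gamma_1'\}$ for $(A')^*$ and $\{\mathcal H^2,\Gamma_0'',\Gamma_1''\}$ for $(A'')^*$, the corresponding Weyl functions coincide. In this case (i.e. whenever the Weyl functions of two such triplets coincide) the self-adjoint extensions $A_0'$ of $A'$ and $A_0''$ of $A''$ with $\operatorname{dom}(A_0')=\ker\Gamma_0'$ and $\operatorname{dom}(A_0'')=\ker\Gamma_0''$ are also unitarily equivalent.
   Context: A symmetric operator is simple if it has no nontrivial reducing subspace on which it is self-adjoint. For a closed densely defined symmetric operator $A$ in $\mathfrak H$, a boundary triplet for $A^*$ is a triple $\{\mathcal H,\Gamma_0,\Gamma_1\}$, where $\mathcal H$ is a Hilbert space and $\Gamma_0,\Gamma_1:\operatorname{dom}(A^* )\to\mathcal H$ are linear maps such that (i) $(A^*f,g)_{\mathfrak H}-(f,A^*g)_{\mathfrak H}=(\Gamma_1f,\Gamma_0g)_{\mathcal H}-(\Gamma_0f,\Gamma_1g)_{\mathcal H}$ for all $f,g\in\operatorname{dom}(A^* )$, and (ii) $f\mapsto(\Gamma_1f,\Gamma_0f)$ maps $\operatorname{dom}(A^* )$ onto $\mathcal H\oplus\mathcal H$. With $A_0=A^*|_{\ker\Gamma_0}$ (self-adjoint) and $\mathfrak N_z=\ker(A^*-z)$, the Weyl function is the function $M(z)$,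 $z\in\rho(A_0)$, with values bounded operators on $\mathcal H$, defined by $M(z)\Gamma_0f_z=\Gamma_1f_z$, $f_z\in\mathfrak N_z$. That two Weyl functions coincide means that their boundary spaces are the same Hilbert space ($\mathcal H^1=\mathcal H^2$) and $M'(z)=M''(z)$ for all $z\in\mathbb C\setminus\mathbb R$. *)

theory Defs
  imports "HOL-Analysis.Analysis" "HOL-Library.Equipollence"
begin

section \<open>Complex Hilbert spaces\<close>

text \<open>The inner product is linear in its first argument and conjugate linear in the second.\<close>

class complex_inner = real_normed_vector +
  fixes scaleC :: "complex \<Rightarrow> 'a \<Rightarrow> 'a" (infixr "*\<^sub>C" 75)
    and cinner :: "'a \<Rightarrow> 'a \<Rightarrow> complex"
  assumes scaleC_add_right: "c *\<^sub>C (x + y) = c *\<^sub>C x + c *\<^sub>C y"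
    and scaleC_add_left: "(c + d) *\<^sub>C x = c *\<^sub>C x + d *\<^sub>C x"
    and scaleC_scaleC: "c *\<^sub>C (d *\<^sub>C x) = (c * d) *\<^sub>C x"
    and scaleC_of_real: "complex_of_real r *\<^sub>C x = r *\<^sub>R x"
    and cinner_commute: "cinner x y = cnj (cinner y x)"
    and cinner_add_left: "cinner (x + y) z = cinner x z + cinner y z"
    and cinner_scaleC_left: "cinner (c *\<^sub>C x) y = c * cinner x y"
    and cinner_self: "cinner x x = complex_of_real ((norm x)\<^sup>2)"

class complex_hilbert = complex_inner + complete_space

global_interpretation complex_vector: vector_space "scaleC :: complex \<Rightarrow> 'a \<Rightarrow> 'a::complex_inner"
  defines csubspace = complex_vector.subspace
    and cspan = complex_vector.span
  by unfold_locales
    (simp_all add: scaleC_add_right scaleC_add_left scaleC_scaleC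
      scaleC_of_real [of 1, simplified])

instantiation complex :: complex_hilbert
begin

definition scaleC_complex :: "complex \<Rightarrow> complex \<Rightarrow> complex"
  where "scaleC_complex c x = c * x"

definition cinner_complex :: "complex \<Rightarrow> complex \<Rightarrow> complex"
  where "cinner_complex x y = x * cnj y"

instance
  by standard
    (simp_all add: scaleC_complex_def cinner_complex_def algebra_simps scaleR_conv_of_real
      complex_norm_square [symmetric])

end

text \<open>The orthogonal sum of two Hilbert spaces.\<close>

instantiation prod :: (complex_inner, complex_inner) complex_inner
begin

definition scaleC_prod :: "complex \<Rightarrow> 'a \<times> 'b \<Rightarrow> 'a \<times> 'b"
  where "scaleC_prod c p = (c *\<^sub>C fst p, c *\<^sub>C snd p)"

definition cinner_prod :: "'a \<times> 'b \<Rightarrow> 'a \<times> 'b \<Rightarrow> complex"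
  where "cinner_prod p q = cinner (fst p) (fst q) + cinner (snd p) (snd q)"

instance
proof
  fix p q :: "'a \<times> 'b"
  show "cinner p q = cnj (cinner q p)"
    by (simp add: cinner_prod_def cinner_commute [of "fst p"] cinner_commute [of "snd p"])
  show "cinner p p = complex_of_real ((norm p)\<^sup>2)"
    by (simp add: cinner_prod_def cinner_self norm_prod_def)
qed (auto simp: scaleC_prod_def cinner_prod_def scaleC_add_right scaleC_add_left scaleC_scaleC
      scaleC_of_real cinner_add_left cinner_scaleC_left algebra_simps prod_eq_iff)

end

instance prod :: (complex_hilbert, complex_hilbert) complex_hilbert ..

definition orth_compl :: "'a::complex_inner set \<Rightarrow> 'a set"
  where "orth_compl L = {x. \<forall>y\<in>L. cinner x y = 0}"

text \<open>The orthogonal projection onto a closed subspace \<open>L\<close>; it is only used for such \<open>L\<close>.\<close>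

definition orth_proj :: "'a::complex_hilbert set \<Rightarrow> 'a \<Rightarrow> 'a"
  where "orth_proj L x = (THE p. p \<in> L \<and> x - p \<in> orth_compl L)"

definition orthonormal_basis_of :: "'a::complex_inner set \<Rightarrow> 'a set \<Rightarrow> bool"
  where "orthonormal_basis_of L B \<longleftrightarrow>
    B \<subseteq> L \<and> (\<forall>x\<in>B. cinner x x = 1) \<and> pairwise (\<lambda>x y. cinner x y = 0) B \<and>
    L \<subseteq> closure (cspan B)"

definition equal_hilbert_dim :: "'a::complex_inner set \<Rightarrow> 'b::complex_inner set \<Rightarrow> bool"
  where "equal_hilbert_dim L K \<longleftrightarrow>
    (\<exists>B C. orthonormal_basis_of L B \<and> orthonormal_basis_of K C \<and> B \<approx> C)"

definition clinear_on :: "'a::complex_inner set \<Rightarrow> ('a \<Rightarrow> 'b::complex_inner) \<Rightarrow> bool"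
  where "clinear_on S T \<longleftrightarrow>
    (\<forall>x\<in>S. \<forall>y\<in>S. T (x + y) = T x + T y) \<and> (\<forall>c. \<forall>x\<in>S. T (c *\<^sub>C x) = c *\<^sub>C T x)"

definition unitary :: "('a::complex_inner \<Rightarrow> 'b::complex_inner) \<Rightarrow> bool"
  where "unitary U \<longleftrightarrow>
    Vector_Spaces.linear scaleC scaleC U \<and> bij U \<and> (\<forall>x y. cinner (U x) (U y) = cinner x y)"

section \<open>Unbounded operators\<close>

text \<open>
  An operator is identified with its graph: \<open>(f, f') \<in> A\<close> says that \<open>f\<close> lies in
  \<open>dom A = Domain A\<close> and \<open>A f = f'\<close>. Thus \<open>B\<close> extends \<open>A\<close> iff \<open>A \<subseteq> B\<close>, and \<open>A\<close> is a closed
  operator iff \<open>closed A\<close> holds in the product topology.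
\<close>

type_synonym ('a, 'b) operator = "('a \<times> 'b) set"

definition linear_operator :: "('a::complex_inner, 'b::complex_inner) operator \<Rightarrow> bool"
  where "linear_operator A \<longleftrightarrow> csubspace A \<and> single_valued A"

definition densely_defined_in :: "'a::complex_inner set \<Rightarrow> ('a, 'a) operator \<Rightarrow> bool"
  where "densely_defined_in L A \<longleftrightarrow> L \<subseteq> closure (Domain A)"

abbreviation densely_defined :: "('a::complex_inner, 'a) operator \<Rightarrow> bool"
  where "densely_defined \<equiv> densely_defined_in UNIV"

definition symmetric_operator :: "('a::complex_inner, 'a) operator \<Rightarrow> bool"
  where "symmetric_operator A \<longleftrightarrow>
    linear_operator A \<and> (\<forall>(f, f')\<in>A. \<forall>(g, g')\<in>A. cinner f' g = cinner f g')"

text \<open>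
  The adjoint of an operator acting in the Hilbert space \<open>L\<close>, where \<open>L\<close> is a closed subspace of
  the ambient space. It is single-valued when the operator is densely defined in \<open>L\<close>.
\<close>

definition adjoint_in :: "'a::complex_inner set \<Rightarrow> ('a, 'a) operator \<Rightarrow> ('a, 'a) operator"
  where "adjoint_in L A =
    {(g, g'). g \<in> L \<and> g' \<in> L \<and> (\<forall>(f, f')\<in>A. cinner f' g = cinner f g')}"

abbreviation adjoint :: "('a::complex_inner, 'a) operator \<Rightarrow> ('a, 'a) operator"
  where "adjoint \<equiv> adjoint_in UNIV"

definition selfadjoint_in :: "'a::complex_inner set \<Rightarrow> ('a, 'a) operator \<Rightarrow> bool"
  where "selfadjoint_in L A \<longleftrightarrow>
    linear_operator A \<and> A \<subseteq> L \<times> L \<and> densely_defined_in L A \<and> adjoint_in L A = A"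

text \<open>\<open>L\<close> reduces \<open>A\<close> if the orthogonal projection \<open>P\<close> onto \<open>L\<close> satisfies \<open>P A \<subseteq> A P\<close>.\<close>

definition reducing_subspace :: "('a::complex_hilbert, 'a) operator \<Rightarrow> 'a set \<Rightarrow> bool"
  where "reducing_subspace A L \<longleftrightarrow>
    csubspace L \<and> closed L \<and> (\<forall>(f, f')\<in>A. (orth_proj L f, orth_proj L f') \<in> A)"

text \<open>
  The part of \<open>A\<close> in \<open>L\<close> is \<open>A \<inter> L \<times> L\<close>. The subspace \<open>L\<close> may be the whole space, so that a
  self-adjoint operator in a nonzero space is not simple.
\<close>

definition simple_operator :: "('a::complex_hilbert, 'a) operator \<Rightarrow> bool"
  where "simple_operator A \<longleftrightarrow>
    \<not> (\<exists>L. reducing_subspace A L \<and> L \<noteq> {0} \<and> selfadjoint_in L (A \<inter> L \<times> L))"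

definition unitarily_equivalent ::
    "('a::complex_inner, 'a) operator \<Rightarrow> ('b::complex_inner, 'b) operator \<Rightarrow> bool"
  where "unitarily_equivalent A B \<longleftrightarrow> (\<exists>U. unitary U \<and> B = map_prod U U ` A)"

definition defect_space :: "('a::complex_inner, 'a) operator \<Rightarrow> complex \<Rightarrow> 'a set"
  where "defect_space A z = {f. (f, z *\<^sub>C f) \<in> adjoint A}"

definition equal_deficiency_indices :: "('a::complex_inner, 'a) operator \<Rightarrow> bool"
  where "equal_deficiency_indices A \<longleftrightarrow>
    equal_hilbert_dim (defect_space A \<i>) (defect_space A (- \<i>))"

section \<open>Boundary triplets and Weyl functions\<close>

text \<open>
  The boundary space is a closed subspace \<open>H\<close> of a Hilbert space; the boundary maps matter only
  on \<open>Domain (adjoint A)\<close>.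
\<close>

definition boundary_triplet ::
    "('a::complex_hilbert, 'a) operator \<Rightarrow> 'h::complex_hilbert set \<Rightarrow> ('a \<Rightarrow> 'h) \<Rightarrow> ('a \<Rightarrow> 'h) \<Rightarrow> bool"
  where "boundary_triplet A H \<Gamma>\<^sub>0 \<Gamma>\<^sub>1 \<longleftrightarrow>
    csubspace H \<and> closed H \<and>
    clinear_on (Domain (adjoint A)) \<Gamma>\<^sub>0 \<and> clinear_on (Domain (adjoint A)) \<Gamma>\<^sub>1 \<and>
    (\<forall>(f, f')\<in>adjoint A. \<forall>(g, g')\<in>adjoint A.
      cinner f' g - cinner f g' = cinner (\<Gamma>\<^sub>1 f) (\<Gamma>\<^sub>0 g) - cinner (\<Gamma>\<^sub>0 f) (\<Gamma>\<^sub>1 g)) \<and>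
    (\<lambda>f. (\<Gamma>\<^sub>1 f, \<Gamma>\<^sub>0 f)) ` Domain (adjoint A) = H \<times> H"

definition kernel_extension ::
    "('a::complex_hilbert, 'a) operator \<Rightarrow> ('a \<Rightarrow> 'h::complex_hilbert) \<Rightarrow> ('a, 'a) operator"
  where "kernel_extension A \<Gamma>\<^sub>0 = {(f, f')\<in>adjoint A. \<Gamma>\<^sub>0 f = 0}"

text \<open>
  The value \<open>M(z)\<close> is again given by its graph: it is the operator sending \<open>\<Gamma>\<^sub>0 f\<close> to \<open>\<Gamma>\<^sub>1 f\<close> for
  \<open>f \<in> ker (A\<^sup>* - z)\<close>. For \<open>z\<close> in the resolvent set of \<open>kernel_extension A \<Gamma>\<^sub>0\<close>, in particular
  for nonreal \<open>z\<close>, this is the graph of a bounded operator defined on all of the boundary space;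
  other \<open>z\<close> are not used.
\<close>

definition weyl_function ::
    "('a::complex_hilbert, 'a) operator \<Rightarrow> ('a \<Rightarrow> 'h::complex_hilbert) \<Rightarrow> ('a \<Rightarrow> 'h) \<Rightarrow>
      complex \<Rightarrow> ('h, 'h) operator"
  where "weyl_function A \<Gamma>\<^sub>0 \<Gamma>\<^sub>1 z = (\<lambda>f. (\<Gamma>\<^sub>0 f, \<Gamma>\<^sub>1 f)) ` defect_space A z"

text \<open>
  Both triplets have the same boundary space \<open>H\<close>. Since the type of \<open>H\<close> cannot be quantified
  existentially, the existence of such triplets is stated with \<open>H\<close> a closed subspace of the space
  in which \<open>A\<close> acts. Every boundary space of \<open>A\<close> is isometric to \<open>ker (A\<^sup>* - z)\<close> for nonreal \<open>z\<close>,
  so this is no restriction up to a unitary change of the boundary space.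
\<close>

definition triplets_with_same_weyl_function ::
    "('a::complex_hilbert, 'a) operator \<Rightarrow> ('b::complex_hilbert, 'b) operator \<Rightarrow>
      'h::complex_hilbert set \<Rightarrow> ('a \<Rightarrow> 'h) \<Rightarrow> ('a \<Rightarrow> 'h) \<Rightarrow> ('b \<Rightarrow> 'h) \<Rightarrow> ('b \<Rightarrow> 'h) \<Rightarrow> bool"
  where "triplets_with_same_weyl_function A B H \<Gamma>\<^sub>0 \<Gamma>\<^sub>1 \<Delta>\<^sub>0 \<Delta>\<^sub>1 \<longleftrightarrow>
    boundary_triplet A H \<Gamma>\<^sub>0 \<Gamma>\<^sub>1 \<and> boundary_triplet B H \<Delta>\<^sub>0 \<Delta>\<^sub>1 \<and>
    (\<forall>z. z \<notin> \<real> \<longrightarrow> weyl_function A \<Gamma>\<^sub>0 \<Gamma>\<^sub>1 z = weyl_function B \<Delta>\<^sub>0 \<Delta>\<^sub>1 z)"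

end

theory Submission
  imports Defs
begin

text \<open>
  A simple symmetric operator is determined by its defect spaces: they span a dense subspace, and
  \<open>(u, u')\<close> belongs to the operator iff \<open>(u', f) = (u, z f)\<close> for all nonreal \<open>z\<close> and
  \<open>f \<in> ker (A\<^sup>* - z)\<close>. By Green's identity
  \<open>(z - cnj w) (f, g) = (M(z) \<Gamma>\<^sub>0 f, \<Gamma>\<^sub>0 g) - (\<Gamma>\<^sub>0 f, M(w) \<Gamma>\<^sub>0 g)\<close> for \<open>f \<in> ker (A\<^sup>* - z)\<close> and
  \<open>g \<in> ker (A\<^sup>* - w)\<close>, so the Weyl function determines all inner products of defect vectors; the
  exceptional case \<open>z = cnj w\<close> follows by continuity in \<open>w\<close>. Hence matching defect vectors with
  equal boundary values extends to a unitary operator intertwining \<open>A\<close> and \<open>B\<close>. It also respects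
  the boundary maps, and therefore the extensions \<open>A\<^sub>0\<close> and \<open>B\<^sub>0\<close>. Conversely, equal deficiency
  indices provide a boundary triplet for \<open>A\<close> via von Neumann's formula, which is carried over to
  \<open>B\<close> by the unitary operator.
\<close>

section \<open>Hilbert space geometry\<close>

lemma cinner_add_right: "cinner x (y + z) = cinner x y + cinner x z"
  by (metis cinner_add_left cinner_commute complex_cnj_add)

lemma cinner_scaleC_right: "cinner x (c *\<^sub>C y) = cnj c * cinner x y"
  by (metis cinner_commute cinner_scaleC_left complex_cnj_mult)

lemma cinner_scaleR_left: "cinner (r *\<^sub>R x) y = r *\<^sub>R cinner x y"
  by (metis cinner_scaleC_left scaleC_of_real scaleR_conv_of_real)

lemma cinner_scaleR_right: "cinner x (r *\<^sub>R y) = r *\<^sub>R cinner x y"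
  by (metis cinner_scaleC_right complex_cnj_complex_of_real scaleC_of_real scaleR_conv_of_real)

lemma cinner_minus_left: "cinner (- x) y = - cinner x y"
  using cinner_scaleR_left [of "-1" x y] by simp

lemma cinner_minus_right: "cinner x (- y) = - cinner x y"
  using cinner_scaleR_right [of x "-1" y] by simp

lemma power2_norm_eq_cinner: "(norm x)\<^sup>2 = Re (cinner x x)"
  by (simp add: cinner_self)

lemma power2_norm_diff: "(norm (x - y))\<^sup>2 = (norm x)\<^sup>2 + (norm y)\<^sup>2 - 2 * Re (cinner x y)"
proof -
  have "cinner (x - y) (x - y) = cinner x x + cinner y y - (cinner x y + cnj (cinner x y))"
    unfolding diff_conv_add_uminus [of x] cinner_add_left cinner_add_right cinner_minus_left
      cinner_minus_right cinner_commute [of y x] by (simp add: algebra_simps)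
  then show ?thesis
    by (simp add: power2_norm_eq_cinner)
qed

lemma norm_scaleC: "norm (c *\<^sub>C x) = cmod c * norm x"
proof -
  have "cinner (c *\<^sub>C x) (c *\<^sub>C x) = (c * cnj c) * cinner x x"
    by (simp add: cinner_scaleC_left cinner_scaleC_right)
  also have "\<dots> = complex_of_real ((cmod c)\<^sup>2 * (norm x)\<^sup>2)"
    unfolding complex_norm_square [symmetric] cinner_self by simp
  finally have "(norm (c *\<^sub>C x))\<^sup>2 = (cmod c * norm x)\<^sup>2"
    unfolding cinner_self of_real_eq_iff by (simp add: power_mult_distrib)
  then show ?thesis
    by (simp add: power2_eq_iff_nonneg)
qed

lemma norm_cinner_le: "cmod (cinner x y) \<le> norm x * norm y"
proof (cases "y = 0")
  case True
  then show ?thesis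
    using cinner_scaleR_right [of x 0 y] by simp
next
  case False
  define a where "a = cinner x y"
  define N where "N = (norm y)\<^sup>2"
  have N: "N > 0"
    using False by (simp add: N_def)
  \<comment> \<open>The vector is \<open>N\<close> times the component of \<open>x\<close>
    orthogonal to \<open>y\<close>; scaling by \<open>N\<close> avoids a division.\<close>
  have "0 \<le> (norm (N *\<^sub>R x - a *\<^sub>C y))\<^sup>2"
    by simp
  also have "\<dots> = N\<^sup>2 * (norm x)\<^sup>2 + (cmod a)\<^sup>2 * N - 2 * Re (of_real N * (a * cnj a))"
    by (simp add: power2_norm_diff norm_scaleC power_mult_distrib cinner_scaleR_left
        cinner_scaleC_right scaleR_conv_of_real N_def a_def mult_ac)
  also have "\<dots> = N * (N * (norm x)\<^sup>2 - (cmod a)\<^sup>2)"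
    unfolding complex_norm_square [symmetric] by (simp add: power2_eq_square algebra_simps)
  finally have "(cmod a)\<^sup>2 \<le> N * (norm x)\<^sup>2"
    using N by (simp add: zero_le_mult_iff)
  then have "(cmod a)\<^sup>2 \<le> (norm x * norm y)\<^sup>2"
    by (simp add: N_def power_mult_distrib mult.commute)
  then show ?thesis
    unfolding a_def by (rule power2_le_imp_le) simp
qed

text \<open>Regarding the inner product and, below, complex scaling as bounded real-bilinear maps
  provides their limit, continuity, zero and difference rules.\<close>

interpretation cinner: bounded_bilinear "cinner :: 'a::complex_inner \<Rightarrow> 'a \<Rightarrow> complex"
  by unfold_locales
    (auto simp: cinner_add_left cinner_add_right cinner_scaleR_left cinner_scaleR_right
      intro!: exI [of _ 1] norm_cinner_le)

interpretation scaleC: bounded_bilinear "scaleC :: complex \<Rightarrow> 'a::complex_inner \<Rightarrow> 'a"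
proof unfold_locales
  fix r a and b :: 'a
  show "(r *\<^sub>R a) *\<^sub>C b = r *\<^sub>R (a *\<^sub>C b)" "a *\<^sub>C (r *\<^sub>R b) = r *\<^sub>R (a *\<^sub>C b)"
    by (simp_all add: scaleR_conv_of_real scaleC_scaleC mult.commute flip: scaleC_of_real)
qed (auto simp: scaleC_add_left scaleC_add_right norm_scaleC intro!: exI [of _ 1])

lemmas cinner_simps = cinner.add_left cinner.add_right cinner.diff_left cinner.diff_right
  cinner_scaleC_left cinner_scaleC_right cinner.minus_left cinner.minus_right

lemma cinner_self_eq_0_iff [simp]: "cinner x x = 0 \<longleftrightarrow> x = 0"
  by (simp add: cinner_self)

lemma cinner_eq_0_sym: "cinner x y = 0 \<longleftrightarrow> cinner y x = 0"
  by (metis cinner_commute complex_cnj_zero)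

section \<open>Complex subspaces, orthogonal complements and projections\<close>

lemma csubspace_diff: "csubspace S \<Longrightarrow> x \<in> S \<Longrightarrow> y \<in> S \<Longrightarrow> x - y \<in> S"
  by (rule complex_vector.subspace_diff)

lemma csubspace_closure:
  assumes "csubspace S"
  shows "csubspace (closure S)"
proof (rule complex_vector.subspaceI)
  show "0 \<in> closure S"
    using assms closure_subset complex_vector.subspace_0 by blast
next
  fix x y
  assume "x \<in> closure S" "y \<in> closure S"
  then obtain f g where "\<And>n. f n \<in> S" "f \<longlonglongrightarrow> x" "\<And>n. g n \<in> S" "g \<longlonglongrightarrow> y"
    unfolding closure_sequential by blast
  then show "x + y \<in> closure S"
    unfolding closure_sequential
    by (intro exI [of _ "\<lambda>n. f n + g n"] conjI allI tendsto_add
        complex_vector.subspace_add [OF assms])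
next
  fix c x
  assume "x \<in> closure S"
  then obtain f where "\<And>n. f n \<in> S" "f \<longlonglongrightarrow> x"
    unfolding closure_sequential by blast
  then show "c *\<^sub>C x \<in> closure S"
    unfolding closure_sequential
    by (intro exI [of _ "\<lambda>n. c *\<^sub>C f n"] conjI allI scaleC.tendsto tendsto_const
        complex_vector.subspace_scale [OF assms])
qed

lemma csubspace_orth_compl: "csubspace (orth_compl L)"
  by (rule complex_vector.subspaceI) (auto simp: orth_compl_def cinner_simps cinner.zero_left)

lemma closed_orth_compl: "closed (orth_compl L)"
proof -
  have "orth_compl L = (\<Inter>y\<in>L. {x. cinner x y = 0})"
    by (auto simp: orth_compl_def)
  also have "closed \<dots>"
    by (intro closed_INT ballI closed_Collect_eq continuous_intros cinner.continuous_on)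
  finally show ?thesis .
qed

text \<open>A minimizing sequence is Cauchy: midpoints of its members lie in \<open>L\<close>, so
  the parallelogram law bounds their mutual distances by the excess of their squared distances to
  \<open>x\<close> over the infimum.\<close>

lemma minimal_distance_attained:
  fixes L :: "'a::complex_hilbert set"
  assumes L: "csubspace L" "closed L"
  obtains p where "p \<in> L" "\<And>y. y \<in> L \<Longrightarrow> norm (x - p) \<le> norm (x - y)"
proof -
  define D where "D = (\<lambda>y. (norm (x - y))\<^sup>2) ` L"
  define d where "d = Inf D"
  have D: "D \<noteq> {}" "bdd_below D"
    using complex_vector.subspace_0 [OF L(1)] by (auto simp: D_def intro!: bdd_belowI [of _ 0])
  have d_le: "d \<le> (norm (x - y))\<^sup>2" if "y \<in> L" for y
    unfolding d_def using that D by (auto simp: D_def intro: cInf_lower)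
  have "\<exists>y\<in>L. (norm (x - y))\<^sup>2 < d + inverse (real (Suc n))" for n
  proof -
    have "Inf D < d + inverse (real (Suc n))"
      by (simp add: d_def)
    then show ?thesis
      using D by (auto simp: cInf_less_iff D_def)
  qed
  then obtain y where y: "\<And>n. y n \<in> L"
    and y_less: "\<And>n. (norm (x - y n))\<^sup>2 < d + inverse (real (Suc n))"
    by metis
  have y_dist: "(norm (y m - y n))\<^sup>2 \<le> 2 * (inverse (real (Suc m)) + inverse (real (Suc n)))" for m n
  proof -
    define u v where "u = x - y m" and "v = x - y n"
    have "(norm (u - v))\<^sup>2 + (norm (u - (- v)))\<^sup>2 = 2 * (norm u)\<^sup>2 + 2 * (norm v)\<^sup>2"
      unfolding power2_norm_diff by (simp add: cinner.minus_right)
    moreover have "u - (- v) = 2 *\<^sub>R (x - (1/2) *\<^sub>R (y m + y n))"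
      by (simp add: u_def v_def algebra_simps scaleR_2)
    then have "(norm (u - (- v)))\<^sup>2 = 4 * (norm (x - (1/2) *\<^sub>R (y m + y n)))\<^sup>2"
      by (simp add: power_mult_distrib)
    moreover have "(1/2) *\<^sub>R (y m + y n) \<in> L"
      using y L(1) by (simp add: complex_vector.subspace_add complex_vector.subspace_scale
          flip: scaleC_of_real)
    ultimately have "(norm (u - v))\<^sup>2 \<le> 2 * (norm u)\<^sup>2 + 2 * (norm v)\<^sup>2 - 4 * d"
      using d_le by fastforce
    then show ?thesis
      using y_less [of m] y_less [of n] by (simp add: u_def v_def norm_minus_commute)
  qed
  have aux: "a \<le> c + c \<Longrightarrow> c < d / 4 \<Longrightarrow> 2 * a < d" for a c d :: real
    by linarith
  have "Cauchy y"
  proof (rule CauchyI)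
    fix e :: real
    assume e: "0 < e"
    then obtain k where k: "inverse (real (Suc k)) < e\<^sup>2 / 4"
      using reals_Archimedean [of "e\<^sup>2 / 4"] by auto
    show "\<exists>M. \<forall>m\<ge>M. \<forall>n\<ge>M. norm (y m - y n) < e"
    proof (intro exI allI impI)
      fix m n
      assume "k \<le> m" "k \<le> n"
      then have "inverse (real (Suc m)) + inverse (real (Suc n)) \<le>
          inverse (real (Suc k)) + inverse (real (Suc k))"
        by (intro add_mono le_imp_inverse_le) auto
      then have "2 * (inverse (real (Suc m)) + inverse (real (Suc n))) < e\<^sup>2"
        using k aux by blast
      then have "(norm (y m - y n))\<^sup>2 < e\<^sup>2"
        by (rule le_less_trans [OF y_dist])
      then show "norm (y m - y n) < e"
        using e by (simp add: power2_less_imp_less)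
    qed
  qed
  then obtain p where p: "y \<longlonglongrightarrow> p"
    using Cauchy_convergent convergent_def by blast
  have "p \<in> L"
    by (rule closed_sequentially [OF L(2) y p])
  have "(\<lambda>n. (norm (x - y n))\<^sup>2) \<longlonglongrightarrow> (norm (x - p))\<^sup>2"
    by (intro tendsto_intros p)
  moreover have "(\<lambda>n. d + inverse (real (Suc n))) \<longlonglongrightarrow> d + 0"
    by (intro tendsto_intros LIMSEQ_inverse_real_of_nat)
  ultimately have "(norm (x - p))\<^sup>2 \<le> d"
    using y_less by (intro LIMSEQ_le [where y = d]) (auto intro!: less_imp_le)
  then have "norm (x - p) \<le> norm (x - y)" if "y \<in> L" for y
    using d_le [OF that] by (meson norm_ge_zero order_trans power2_le_imp_le)
  with \<open>p \<in> L\<close> show ?thesis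
    using that by blast
qed

text \<open>The point of \<open>L\<close> nearest to \<open>x\<close> serves as \<open>p\<close>: if
  \<open>x - p\<close> had a nonzero inner product with some \<open>y\<close> in \<open>L\<close>, a
  small move along \<open>y\<close> would come closer to \<open>x\<close>.\<close>

lemma orthogonal_decomposition:
  fixes L :: "'a::complex_hilbert set"
  assumes L: "csubspace L" "closed L"
  obtains p where "p \<in> L" "x - p \<in> orth_compl L"
proof -
  obtain p where p: "p \<in> L" and min: "\<And>y. y \<in> L \<Longrightarrow> norm (x - p) \<le> norm (x - y)"
    using minimal_distance_attained [OF L] by metis
  have "cinner (x - p) y = 0" if y: "y \<in> L" for y
  proof -
    define a where "a = cinner (x - p) y"
    \<comment> \<open>The summand 1 covers \<open>y = 0\<close> and gives
      \<open>t * (norm y)\<^sup>2 < 1\<close>, so that the factor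
      \<open>t * (norm y)\<^sup>2 - 2\<close> below is negative.\<close>
    define t where "t = 1 / ((norm y)\<^sup>2 + 1)"
    have pos: "(norm y)\<^sup>2 + 1 > 0"
      by (simp add: add_nonneg_pos)
    have t: "t > 0" "t * (norm y)\<^sup>2 < 1"
      unfolding t_def using pos by (auto simp: field_simps)
    have "p + (of_real t * a) *\<^sub>C y \<in> L"
      using p y L(1) by (simp add: complex_vector.subspace_add complex_vector.subspace_scale)
    then have "(norm (x - p))\<^sup>2 \<le> (norm ((x - p) - (of_real t * a) *\<^sub>C y))\<^sup>2"
      using min by (simp add: diff_diff_eq)
    also have "\<dots> = (norm (x - p))\<^sup>2 + (t * cmod a * norm y)\<^sup>2 - 2 * Re (of_real t * (a * cnj a))"
      using t by (simp only: power2_norm_diff norm_scaleC cinner_scaleC_right a_def [symmetric])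
        (simp add: norm_mult mult_ac)
    also have "\<dots> = (norm (x - p))\<^sup>2 + t * (cmod a)\<^sup>2 * (t * (norm y)\<^sup>2 - 2)"
      unfolding complex_norm_square [symmetric]
      by (simp add: power_mult_distrib power2_eq_square algebra_simps)
    finally have "0 \<le> t * (cmod a)\<^sup>2 * (t * (norm y)\<^sup>2 - 2)"
      by simp
    then have "(cmod a)\<^sup>2 \<le> 0"
      using t by (smt (verit) mult_pos_neg mult_pos_pos)
    then show ?thesis
      by (simp add: a_def)
  qed
  then show ?thesis
    using that p by (simp add: orth_compl_def)
qed

lemma orth_compl_Int_self: "x \<in> L \<Longrightarrow> x \<in> orth_compl L \<Longrightarrow> x = 0"
  by (auto simp: orth_compl_def)

lemma orth_proj_eqI:
  fixes L :: "'a::complex_hilbert set"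
  assumes "csubspace L" "p \<in> L" "x - p \<in> orth_compl L"
  shows "orth_proj L x = p"
  unfolding orth_proj_def
proof (rule the_equality)
  fix q
  assume q: "q \<in> L \<and> x - q \<in> orth_compl L"
  then have "(x - p) - (x - q) \<in> orth_compl L"
    using assms csubspace_orth_compl csubspace_diff by blast
  then have "q - p \<in> orth_compl L"
    by simp
  moreover have "q - p \<in> L"
    using assms q csubspace_diff by blast
  ultimately show "q = p"
    using orth_compl_Int_self [of "q - p"] by simp
qed (use assms in auto)

lemma
  fixes L :: "'a::complex_hilbert set"
  assumes "csubspace L" "closed L"
  shows orth_proj_in: "orth_proj L x \<in> L"
    and diff_orth_proj_in: "x - orth_proj L x \<in> orth_compl L"
  using orthogonal_decomposition [OF assms, of x] orth_proj_eqI [OF assms(1)] by metis+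

lemma cinner_orth_proj:
  fixes L :: "'a::complex_hilbert set"
  assumes "csubspace L" "closed L" "y \<in> L"
  shows "cinner y (orth_proj L x) = cinner y x"
proof -
  have "cinner (x - orth_proj L x) y = 0"
    using diff_orth_proj_in [OF assms(1,2)] assms(3) by (auto simp: orth_compl_def)
  then have "cinner y (x - orth_proj L x) = 0"
    by (subst cinner_eq_0_sym)
  then show ?thesis
    by (simp add: cinner_simps)
qed

lemma orth_compl_orth_compl:
  fixes L :: "'a::complex_hilbert set"
  assumes "csubspace L" "closed L"
  shows "orth_compl (orth_compl L) = L"
proof
  show "orth_compl (orth_compl L) \<subseteq> L"
  proof
    fix x
    assume x: "x \<in> orth_compl (orth_compl L)"
    obtain p where p: "p \<in> L" "x - p \<in> orth_compl L"
      using orthogonal_decomposition [OF assms] by metis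
    then have "cinner x (x - p) = 0" "cinner (x - p) p = 0"
      using x by (auto simp: orth_compl_def)
    then have "cinner (x - p) (x - p) = 0"
      using cinner_eq_0_sym [of p "x - p"] by (simp add: cinner.diff_left [of x p "x - p"])
    then show "x \<in> L"
      using p by simp
  qed
  show "L \<subseteq> orth_compl (orth_compl L)"
    using cinner_eq_0_sym by (auto simp: orth_compl_def)
qed

lemma orth_compl_zero: "orth_compl {0} = UNIV"
  by (simp add: orth_compl_def cinner.zero_right)

lemma orth_compl_closure_cspan: "orth_compl (closure (cspan S)) = orth_compl S"
proof
  show "orth_compl (closure (cspan S)) \<subseteq> orth_compl S"
    using closure_subset complex_vector.span_superset unfolding orth_compl_def by blast
  show "orth_compl S \<subseteq> orth_compl (closure (cspan S))"
  proof
    fix x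
    assume "x \<in> orth_compl S"
    then have "S \<subseteq> orth_compl {x}"
      using cinner_eq_0_sym by (auto simp: orth_compl_def)
    then have "closure (cspan S) \<subseteq> orth_compl {x}"
      by (intro closure_minimal complex_vector.span_minimal csubspace_orth_compl closed_orth_compl)
    then show "x \<in> orth_compl (closure (cspan S))"
      using cinner_eq_0_sym by (auto simp: orth_compl_def)
  qed
qed

lemma closure_cspan_eq_UNIV:
  fixes S :: "'a::complex_hilbert set"
  assumes "orth_compl S = {0}"
  shows "closure (cspan S) = UNIV"
proof -
  have "closure (cspan S) = orth_compl (orth_compl (closure (cspan S)))"
    by (rule orth_compl_orth_compl [symmetric])
      (simp_all add: csubspace_closure complex_vector.subspace_span)
  then show ?thesis
    by (simp add: orth_compl_closure_cspan assms orth_compl_zero)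
qed

section \<open>Subspaces of products as linear relations, and extension of isometries\<close>

text \<open>The bound, applied to differences, turns a convergent sequence of first components into
  a Cauchy sequence of second components, and the closed graph keeps the limit. This later gives
  closed ranges of \<open>A - z\<close> and the exact domain and range of an extended
  isometry.\<close>

lemma closed_Domain:
  fixes G :: "('a::complex_hilbert \<times> 'b::complex_hilbert) set"
  assumes "csubspace G" "closed G" and bound: "\<And>x y. (x, y) \<in> G \<Longrightarrow> norm y \<le> K * norm x"
  shows "closed (Domain G)"
  unfolding closed_sequential_limits
proof (intro allI impI)
  fix X x
  assume "(\<forall>n. X n \<in> Domain G) \<and> X \<longlonglongrightarrow> x"
  then have "\<forall>n. \<exists>y. (X n, y) \<in> G" and X: "X \<longlonglongrightarrow> x"
    by blast+
  then obtain Y where Y: "\<And>n. (X n, Y n) \<in> G"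
    by metis
  have dist: "norm (Y m - Y n) \<le> (\<bar>K\<bar> + 1) * norm (X m - X n)" for m n
  proof -
    have "(X m, Y m) - (X n, Y n) \<in> G"
      using Y assms(1) csubspace_diff by blast
    then have "norm (Y m - Y n) \<le> K * norm (X m - X n)"
      by (simp add: bound)
    also have "\<dots> \<le> (\<bar>K\<bar> + 1) * norm (X m - X n)"
      by (intro mult_right_mono) auto
    finally show ?thesis .
  qed
  have "Cauchy Y"
  proof (rule CauchyI)
    fix e :: real
    assume "0 < e"
    then have "0 < e / (\<bar>K\<bar> + 1)"
      by (intro divide_pos_pos) auto
    then obtain M where M: "\<And>m n. m \<ge> M \<Longrightarrow> n \<ge> M \<Longrightarrow> norm (X m - X n) < e / (\<bar>K\<bar> + 1)"
      using CauchyD [OF LIMSEQ_imp_Cauchy [OF X]] by blast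
    have "norm (Y m - Y n) < e" if "m \<ge> M" "n \<ge> M" for m n
    proof -
      have "\<bar>K\<bar> + 1 > 0"
        by (simp add: add_nonneg_pos)
      then have "(\<bar>K\<bar> + 1) * norm (X m - X n) < e"
        using M [OF that] by (simp add: pos_less_divide_eq mult.commute)
      then show ?thesis
        using dist [of m n] by linarith
    qed
    then show "\<exists>M. \<forall>m\<ge>M. \<forall>n\<ge>M. norm (Y m - Y n) < e"
      by blast
  qed
  then obtain y where "Y \<longlonglongrightarrow> y"
    using Cauchy_convergent convergent_def by blast
  then have "(x, y) \<in> G"
    using closed_sequentially [OF assms(2), of "\<lambda>n. (X n, Y n)"] Y X tendsto_Pair by blast
  then show "x \<in> Domain G"
    by blast
qed

lemma csubspace_Times:
  fixes L :: "'a::complex_inner set" and K :: "'b::complex_inner set"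
  assumes "csubspace L" "csubspace K"
  shows "csubspace (L \<times> K)"
  using assms
  by (auto intro!: complex_vector.subspaceI
      simp: scaleC_prod_def zero_prod_def
        complex_vector.subspace_0 complex_vector.subspace_add complex_vector.subspace_scale)

lemma
  assumes "csubspace G"
  shows csubspace_PairD_0: "(0, 0) \<in> G"
    and csubspace_PairD_add: "(x, y) \<in> G \<Longrightarrow> (x', y') \<in> G \<Longrightarrow> (x + x', y + y') \<in> G"
    and csubspace_PairD_diff: "(x, y) \<in> G \<Longrightarrow> (x', y') \<in> G \<Longrightarrow> (x - x', y - y') \<in> G"
    and csubspace_PairD_scale: "(x, y) \<in> G \<Longrightarrow> (c *\<^sub>C x, c *\<^sub>C y) \<in> G"
  using complex_vector.subspace_0 [OF assms] complex_vector.subspace_add [OF assms, of "(x, y)" "(x', y')"]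
    csubspace_diff [OF assms, of "(x, y)" "(x', y')"]
    complex_vector.subspace_scale [OF assms, of "(x, y)" c]
  by (simp_all add: scaleC_prod_def zero_prod_def)

lemma csubspace_Domain: "csubspace G \<Longrightarrow> csubspace (Domain G)"
  by (rule complex_vector.subspaceI)
    (blast intro: csubspace_PairD_0 csubspace_PairD_add csubspace_PairD_scale)+

lemma csubspace_converse:
  assumes "csubspace G"
  shows "csubspace (G\<inverse>)"
proof (rule complex_vector.subspaceI)
  show "0 \<in> G\<inverse>"
    using csubspace_PairD_0 [OF assms] by (simp add: zero_prod_def)
qed (use csubspace_PairD_add [OF assms] csubspace_PairD_scale [OF assms] in
    \<open>auto simp: scaleC_prod_def\<close>)

lemma closed_converse:
  fixes G :: "('a::topological_space \<times> 'b::topological_space) set"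
  assumes "closed G"
  shows "closed (G\<inverse>)"
proof -
  have "G\<inverse> = prod.swap -` G"
    by auto
  moreover have "continuous_on UNIV (prod.swap :: 'b \<times> 'a \<Rightarrow> 'a \<times> 'b)"
    unfolding prod.swap_def by (intro continuous_intros)
  ultimately show ?thesis
    using assms by (simp add: closed_vimage)
qed

text \<open>The graph of the extension is the closed linear span of \<open>S\<close> in the orthogonal sum.\<close>

lemma isometric_extension:
  fixes S :: "('a::complex_hilbert \<times> 'b::complex_hilbert) set"
  assumes gram: "\<And>x y x' y'. (x, y) \<in> S \<Longrightarrow> (x', y') \<in> S \<Longrightarrow> cinner x x' = cinner y y'"
  obtains U where "clinear_on (closure (cspan (Domain S))) U"
    and "U ` closure (cspan (Domain S)) = closure (cspan (Range S))"
    and "\<And>x x'. x \<in> closure (cspan (Domain S)) \<Longrightarrow> x' \<in> closure (cspan (Domain S)) \<Longrightarrow>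
      cinner (U x) (U x') = cinner x x'"
    and "\<And>x y. (x, y) \<in> S \<Longrightarrow> U x = y"
proof -
  define G where "G = closure (cspan S)"
  \<comment> \<open>Orthogonality to \<open>J q\<close> expresses that the inner products of the
    first and of the second components agree. As an ordinary orthogonality condition it passes from
    \<open>S\<close> to the closed span, first in one argument and then in the other.\<close>
  define J :: "'a \<times> 'b \<Rightarrow> 'a \<times> 'b" where "J = (\<lambda>p. (fst p, - snd p))"
  have G: "csubspace G" "closed G" "S \<subseteq> G"
    using closure_subset complex_vector.span_superset
    by (auto simp: G_def csubspace_closure complex_vector.subspace_span)
  have J: "cinner p (J q) = cinner (fst p) (fst q) - cinner (snd p) (snd q)" for p q
    by (simp add: cinner_prod_def J_def cinner_simps)
  have J_sym: "cinner p (J q) = 0 \<longleftrightarrow> cinner q (J p) = 0" for p q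
    unfolding J cinner_commute [of "fst q"] cinner_commute [of "snd q"]
    by (simp flip: complex_cnj_diff)
  have SS: "cinner p (J q) = 0" if "p \<in> S" "q \<in> S" for p q
    using gram [of "fst p" "snd p" "fst q" "snd q"] that by (simp add: J)
  have extend: "cinner p (J q) = 0" if "\<And>p. p \<in> S \<Longrightarrow> cinner p (J q) = 0" "p \<in> G" for p q
  proof -
    have "G \<subseteq> orth_compl {J q}"
      unfolding G_def using that(1)
      by (intro closure_minimal complex_vector.span_minimal csubspace_orth_compl closed_orth_compl)
        (auto simp: orth_compl_def)
    then show ?thesis
      using that(2) by (auto simp: orth_compl_def)
  qed
  have GG: "cinner x x' = cinner y y'" if "(x, y) \<in> G" "(x', y') \<in> G" for x y x' y'
  proof -
    have "cinner (x, y) (J q) = 0" if "q \<in> S" for q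
      using extend [of q] SS that \<open>(x, y) \<in> G\<close> by blast
    then have "cinner (x', y') (J (x, y)) = 0"
      using extend J_sym \<open>(x', y') \<in> G\<close> by blast
    then have "cinner (x, y) (J (x', y')) = 0"
      using J_sym by blast
    then show ?thesis
      by (simp add: J)
  qed
  have norm: "norm x = norm y" if "(x, y) \<in> G" for x y
  proof -
    have "(norm x)\<^sup>2 = (norm y)\<^sup>2"
      unfolding power2_norm_eq_cinner GG [OF that that] ..
    then show ?thesis
      by simp
  qed
  have "S \<subseteq> closure (cspan (Domain S)) \<times> closure (cspan (Range S))"
    using subset_trans [OF complex_vector.span_superset closure_subset, of "Domain S"]
      subset_trans [OF complex_vector.span_superset closure_subset, of "Range S"]
    by (auto dest: DomainI RangeI)
  then have "G \<subseteq> closure (cspan (Domain S)) \<times> closure (cspan (Range S))"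
    unfolding G_def
    by (intro closure_minimal complex_vector.span_minimal csubspace_Times csubspace_closure
        closed_Times complex_vector.subspace_span closed_closure)
  moreover have "closure (cspan (Domain S)) \<subseteq> Domain G"
    using G norm
    by (intro closure_minimal complex_vector.span_minimal csubspace_Domain closed_Domain [of G 1])
      auto
  \<comment> \<open>Equality of norms is symmetric, so the closed-domain argument applies to the
    converse relation as well.\<close>
  moreover have "closure (cspan (Range S)) \<subseteq> Domain (G\<inverse>)"
    using G norm
    by (intro closure_minimal complex_vector.span_minimal csubspace_Domain closed_Domain [of "G\<inverse>" 1]
        csubspace_converse closed_converse) auto
  ultimately have Dom: "Domain G = closure (cspan (Domain S))"
    and Ran: "Range G = closure (cspan (Range S))"
    by auto
  define U where "U = (\<lambda>x. SOME y. (x, y) \<in> G)"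
  have unique: "y = y'" if "(x, y) \<in> G" "(x, y') \<in> G" for x y y'
    using norm [OF csubspace_PairD_diff [OF G(1) that]] by simp
  have U_eq: "U x = y" if "(x, y) \<in> G" for x y
    using unique that unfolding U_def by blast
  have U: "(x, U x) \<in> G" if "x \<in> Domain G" for x
    using that U_eq by blast
  show thesis
  proof
    show "clinear_on (closure (cspan (Domain S))) U"
      unfolding clinear_on_def Dom [symmetric]
      using csubspace_PairD_add [OF G(1)] csubspace_PairD_scale [OF G(1)] U U_eq by meson
    show "U ` closure (cspan (Domain S)) = closure (cspan (Range S))"
      unfolding Dom [symmetric] Ran [symmetric] using U U_eq by force
    show "cinner (U x) (U x') = cinner x x'"
      if "x \<in> closure (cspan (Domain S))" "x' \<in> closure (cspan (Domain S))" for x x'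
      using GG U that unfolding Dom [symmetric] by metis
    show "U x = y" if "(x, y) \<in> S" for x y
      using that G(3) U_eq by blast
  qed
qed

lemma isometric_extension_unitary:
  fixes S :: "('a::complex_hilbert \<times> 'b::complex_hilbert) set"
  assumes "\<And>x y x' y'. (x, y) \<in> S \<Longrightarrow> (x', y') \<in> S \<Longrightarrow> cinner x x' = cinner y y'"
    and "closure (cspan (Domain S)) = UNIV" "closure (cspan (Range S)) = UNIV"
  obtains U where "unitary U" "\<And>x y. (x, y) \<in> S \<Longrightarrow> U x = y"
proof -
  obtain U where U: "clinear_on UNIV U" "range U = UNIV"
      "\<And>x x'. cinner (U x) (U x') = cinner x x'"
    and S: "\<And>x y. (x, y) \<in> S \<Longrightarrow> U x = y"
    using isometric_extension [of S, OF assms(1)] unfolding assms(2,3) by (metis UNIV_I)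
  have diff: "U (x - y) = U x - U y" for x y
    using U(1) unfolding clinear_on_def by (metis UNIV_I add_diff_cancel_right' diff_add_cancel)
  have "inj U"
  proof (rule injI)
    fix x y
    assume "U x = U y"
    then have "cinner (x - y) (x - y) = 0"
      by (metis U(3) diff cancel_comm_monoid_add_class.diff_cancel cinner.zero_left)
    then show "x = y"
      by simp
  qed
  moreover have "Vector_Spaces.linear scaleC scaleC U"
    using U(1) unfolding clinear_on_def by unfold_locales auto
  ultimately have "unitary U"
    using U by (simp add: unitary_def bij_def)
  then show thesis
    using that S by blast
qed

section \<open>Symmetric operators and their defect spaces\<close>

definition shifted_range :: "('a::complex_inner, 'a) operator \<Rightarrow> complex \<Rightarrow> 'a set"
  where "shifted_range A z = (\<lambda>(f, f'). f' - z *\<^sub>C f) ` A"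

lemma shifted_rangeI: "(f, f') \<in> A \<Longrightarrow> f' - z *\<^sub>C f \<in> shifted_range A z"
  by (force simp: shifted_range_def)

lemma shifted_rangeE:
  assumes "g \<in> shifted_range A z"
  obtains f f' where "(f, f') \<in> A" "g = f' - z *\<^sub>C f"
  using assms by (auto simp: shifted_range_def)

lemma symmetric_operatorD:
  assumes "symmetric_operator A"
  shows "csubspace A" "single_valued A"
    and "(f, f') \<in> A \<Longrightarrow> (g, g') \<in> A \<Longrightarrow> cinner f' g = cinner f g'"
  using assms by (auto simp: symmetric_operator_def linear_operator_def)

text \<open>Symmetry makes \<open>cinner f' f\<close> real, so the inner product of
  \<open>f' - z *\<^sub>C f\<close> with \<open>f\<close> has imaginary part
  \<open>- Im z * (norm f)\<^sup>2\<close>; Cauchy-Schwarz does the rest.\<close>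

lemma symmetric_lower_bound:
  assumes "symmetric_operator A" "(f, f') \<in> A"
  shows "\<bar>Im z\<bar> * norm f \<le> norm (f' - z *\<^sub>C f)"
proof (cases "f = 0")
  case False
  have "cinner f' f = cnj (cinner f' f)"
    using symmetric_operatorD(3) [OF assms(1) assms(2) assms(2)] cinner_commute by metis
  then have "Im (cinner f' f) = 0"
    by (metis Reals_cnj_iff complex_is_Real_iff)
  then have "Im (cinner (f' - z *\<^sub>C f) f) = - Im z * (norm f)\<^sup>2"
    by (simp add: cinner_simps cinner_self)
  then have "\<bar>Im z\<bar> * norm f * norm f = \<bar>Im (cinner (f' - z *\<^sub>C f) f)\<bar>"
    by (simp add: abs_mult power2_eq_square)
  also have "\<dots> \<le> norm (f' - z *\<^sub>C f) * norm f"
    using abs_Im_le_cmod norm_cinner_le order_trans by blast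
  finally show ?thesis
    using False by simp
qed simp

lemma adjoint_iff:
  "(g, g') \<in> adjoint A \<longleftrightarrow> (\<forall>f f'. (f, f') \<in> A \<longrightarrow> cinner f' g = cinner f g')"
  by (auto simp: adjoint_in_def)

text \<open>With the graph rotated by a right angle, the adjoint is an orthogonal complement, so
  that it is a closed subspace at once.\<close>

lemma adjoint_eq_orth_compl: "adjoint A = orth_compl ((\<lambda>(f, f'). (- f', f)) ` A)"
proof -
  have "cinner f' g = cinner f g' \<longleftrightarrow> cinner (g, g') (- f', f) = 0" for f f' g g' :: 'a
    using cinner_commute [of g f'] cinner_commute [of g' f]
    by (auto simp: cinner_prod_def cinner_simps)
  then show ?thesis
    by (auto simp: adjoint_in_def orth_compl_def)
qed

lemma csubspace_adjoint: "csubspace (adjoint A)"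
  by (simp add: adjoint_eq_orth_compl csubspace_orth_compl)

lemma closed_adjoint: "closed (adjoint A)"
  by (simp add: adjoint_eq_orth_compl closed_orth_compl)

lemma symmetric_subset_adjoint: "symmetric_operator A \<Longrightarrow> A \<subseteq> adjoint A"
  by (auto simp: adjoint_iff symmetric_operatorD)

lemma adjoint_antimono: "A \<subseteq> B \<Longrightarrow> adjoint B \<subseteq> adjoint A"
  by (auto simp: adjoint_iff subset_iff)

text \<open>Two values at the same vector differ by a vector orthogonal to the dense domain, hence
  to itself.\<close>

lemma single_valued_adjoint:
  assumes "densely_defined A"
  shows "single_valued (adjoint A)"
proof (rule single_valuedI)
  fix g x y
  assume "(g, x) \<in> adjoint A" "(g, y) \<in> adjoint A"
  then have "Domain A \<subseteq> orth_compl {x - y}"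
    by (auto simp: adjoint_iff orth_compl_def cinner_simps)
  then have "closure (Domain A) \<subseteq> orth_compl {x - y}"
    by (intro closure_minimal closed_orth_compl)
  then have "x - y \<in> orth_compl {x - y}"
    using assms by (auto simp: densely_defined_in_def)
  then show "x = y"
    by (simp add: orth_compl_def)
qed

lemma orth_compl_shifted_range: "orth_compl (shifted_range A z) = defect_space A (cnj z)"
proof -
  have "cinner f' g = cinner f (cnj z *\<^sub>C g) \<longleftrightarrow> cinner g (f' - z *\<^sub>C f) = 0" for f f' g :: 'a
    unfolding cinner_eq_0_sym [of g] by (simp add: cinner_simps)
  then show ?thesis
    by (auto simp: defect_space_def adjoint_in_def orth_compl_def shifted_range_def)
qed

lemma csubspace_defect_space: "csubspace (defect_space A z)"
  using orth_compl_shifted_range [of A "cnj z"] csubspace_orth_compl by (metis complex_cnj_cnj)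

lemma closed_defect_space: "closed (defect_space A z)"
  using orth_compl_shifted_range [of A "cnj z"] closed_orth_compl by (metis complex_cnj_cnj)

lemma csubspace_shifted_range:
  assumes "csubspace A"
  shows "csubspace (shifted_range A z)"
proof (rule complex_vector.subspaceI)
  show "0 \<in> shifted_range A z"
    using shifted_rangeI [OF csubspace_PairD_0 [OF assms], of z] by simp
next
  fix x y
  assume "x \<in> shifted_range A z" "y \<in> shifted_range A z"
  then obtain f f' g g' where x: "(f, f') \<in> A" "x = f' - z *\<^sub>C f"
    and y: "(g, g') \<in> A" "y = g' - z *\<^sub>C g"
    by (auto elim!: shifted_rangeE)
  have "x + y = f' + g' - z *\<^sub>C (f + g)"
    by (simp add: x y scaleC_add_right)
  then show "x + y \<in> shifted_range A z"
    using shifted_rangeI csubspace_PairD_add [OF assms x(1) y(1)] by simp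
next
  fix c x
  assume "x \<in> shifted_range A z"
  then obtain f f' where "(f, f') \<in> A" "x = f' - z *\<^sub>C f"
    by (auto elim!: shifted_rangeE)
  then show "c *\<^sub>C x \<in> shifted_range A z"
    using shifted_rangeI [OF csubspace_PairD_scale [OF assms, of f f' c], of z]
    by (simp add: scaleC.diff_right scaleC_scaleC mult.commute)
qed

text \<open>For nonreal \<open>z\<close> the inverse of \<open>A - z\<close> is bounded by
  \<open>1 / \<bar>Im z\<bar>\<close> and has a closed graph, so its domain is closed.\<close>

lemma closed_shifted_range:
  fixes A :: "('a::complex_hilbert, 'a) operator"
  assumes A: "symmetric_operator A" "closed A" and z: "z \<notin> \<real>"
  shows "closed (shifted_range A z)"
proof -
  \<comment> \<open>The preimage \<open>G\<close> of \<open>A\<close> under \<open>T\<close> is the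
    graph of the inverse of \<open>A - z\<close>.\<close>
  define T :: "'a \<times> 'a \<Rightarrow> 'a \<times> 'a" where "T = (\<lambda>(g, f). (f, g + z *\<^sub>C f))"
  define G where "G = T -` A"
  note sub = symmetric_operatorD(1) [OF A(1)]
  have "continuous_on UNIV T"
    unfolding T_def case_prod_unfold by (intro continuous_intros scaleC.continuous_on)
  then have "closed G"
    using A(2) by (simp add: G_def closed_vimage)
  moreover have "csubspace G"
    unfolding G_def
  proof (rule complex_vector.subspaceI)
    show "0 \<in> T -` A"
      using csubspace_PairD_0 [OF sub] by (simp add: T_def zero_prod_def scaleC.zero_right)
  next
    fix p q
    assume "p \<in> T -` A" "q \<in> T -` A"
    moreover have "T (p + q) = T p + T q"
      by (simp add: T_def case_prod_unfold scaleC_add_right algebra_simps)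
    ultimately show "p + q \<in> T -` A"
      using complex_vector.subspace_add [OF sub] by simp
  next
    fix c p
    assume "p \<in> T -` A"
    moreover have "T (c *\<^sub>C p) = c *\<^sub>C T p"
      by (simp add: T_def case_prod_unfold scaleC_prod_def scaleC_add_right scaleC_scaleC mult.commute)
    ultimately show "c *\<^sub>C p \<in> T -` A"
      using complex_vector.subspace_scale [OF sub] by simp
  qed
  moreover have "norm f \<le> (1 / \<bar>Im z\<bar>) * norm g" if "(g, f) \<in> G" for g f
    using symmetric_lower_bound [OF A(1), of f "g + z *\<^sub>C f" z] that z
    by (simp add: G_def T_def complex_is_Real_iff pos_le_divide_eq mult.commute)
  ultimately have "closed (Domain G)"
    using closed_Domain by blast
  moreover have "Domain G = shifted_range A z"
  proof (intro set_eqI iffI)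
    fix g
    assume "g \<in> Domain G"
    then obtain f where "(f, g + z *\<^sub>C f) \<in> A"
      by (auto simp: G_def T_def)
    then show "g \<in> shifted_range A z"
      using shifted_rangeI [of f "g + z *\<^sub>C f" A z] by simp
  next
    fix g
    assume "g \<in> shifted_range A z"
    then obtain f f' where "(f, f') \<in> A" "g = f' - z *\<^sub>C f"
      by (rule shifted_rangeE)
    then have "(g, f) \<in> G"
      by (simp add: G_def T_def)
    then show "g \<in> Domain G"
      by blast
  qed
  ultimately show ?thesis
    by simp
qed

lemma shifted_range_eq:
  fixes A :: "('a::complex_hilbert, 'a) operator"
  assumes "symmetric_operator A" "closed A" "z \<notin> \<real>"
  shows "shifted_range A z = orth_compl (defect_space A (cnj z))"
  using orth_compl_orth_compl [OF csubspace_shifted_range closed_shifted_range] assms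
    symmetric_operatorD(1) by (metis orth_compl_shifted_range)

lemma Reals_cnj_notin: "z \<notin> \<real> \<Longrightarrow> cnj z \<notin> \<real>"
  by (simp add: complex_is_Real_iff)

lemma real_shift_notin: "z \<notin> \<real> \<Longrightarrow> z + complex_of_real t \<notin> \<real>"
  by (simp add: complex_is_Real_iff)

text \<open>Serves to let \<open>t\<close> tend to 0 in the estimates where a nonreal point is
  shifted by \<open>t\<close>. The choice \<open>t = a / (2 * (\<bar>C\<bar> + 1))\<close> yields
  \<open>a \<le> a / 2\<close>, whatever the sign of \<open>C\<close>.\<close>

lemma nonneg_le_small_mult_imp_0:
  fixes a C :: real
  assumes "0 \<le> a" and small: "\<And>t. 0 < t \<Longrightarrow> a \<le> t * C"
  shows "a = 0"
proof (rule ccontr)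
  assume "a \<noteq> 0"
  then have a: "a > 0"
    using assms(1) by simp
  then have "a \<le> (a / (2 * (\<bar>C\<bar> + 1))) * C"
    by (intro small divide_pos_pos) auto
  also have "\<dots> \<le> (a / (2 * (\<bar>C\<bar> + 1))) * (\<bar>C\<bar> + 1)"
    using a by (intro mult_left_mono) auto
  also have "\<dots> = a / 2"
    by (simp add: field_simps add_nonneg_eq_0_iff)
  finally show False
    using a by simp
qed

text \<open>For \<open>w = z + t\<close> the vector \<open>d\<close> has the form
  \<open>(A - cnj w) x\<close>, and then \<open>(d, f) = - t (x, f)\<close> for every defect vector
  \<open>f\<close> at \<open>z\<close>. The horizontal shift keeps the imaginary part, so
  \<open>norm x \<le> norm d / \<bar>Im z\<bar>\<close> uniformly in \<open>t\<close>.\<close>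

lemma orth_compl_defect_space_limit:
  fixes A :: "('a::complex_hilbert, 'a) operator"
  assumes A: "symmetric_operator A" "closed A" and z: "z \<notin> \<real>"
    and d: "\<And>w. w \<notin> \<real> \<Longrightarrow> w \<noteq> z \<Longrightarrow> d \<in> orth_compl (defect_space A w)"
  shows "d \<in> orth_compl (defect_space A z)"
proof -
  have "cinner d f = 0" if f: "f \<in> defect_space A z" for f
  proof -
    have Im: "\<bar>Im z\<bar> > 0"
      using z by (simp add: complex_is_Real_iff)
    have "cmod (cinner d f) \<le> t * (norm d * norm f / \<bar>Im z\<bar>)" if t: "t > 0" for t
    proof -
      define w where "w = z + complex_of_real t"
      have w: "w \<notin> \<real>" "w \<noteq> z"
        using real_shift_notin [OF z] t by (auto simp: w_def)
      then have "d \<in> shifted_range A (cnj w)"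
        using shifted_range_eq [OF A Reals_cnj_notin, of w] d by simp
      then obtain x x' where x: "(x, x') \<in> A" "d = x' - cnj w *\<^sub>C x"
        by (rule shifted_rangeE)
      have "cinner x' f = cinner x (z *\<^sub>C f)"
        using f x(1) by (simp add: defect_space_def adjoint_iff)
      then have "cinner d f = - complex_of_real t * cinner x f"
        by (simp add: x(2) cinner_simps w_def algebra_simps)
      then have "cmod (cinner d f) \<le> t * (norm x * norm f)"
        using norm_cinner_le [of x f] t by (simp add: norm_mult)
      moreover have "norm x \<le> norm d / \<bar>Im z\<bar>"
        using symmetric_lower_bound [OF A(1) x(1), of "cnj w"] Im
        by (simp add: x(2) w_def pos_le_divide_eq mult.commute)
      then have "t * (norm x * norm f) \<le> t * (norm d / \<bar>Im z\<bar> * norm f)"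
        using t by (intro mult_left_mono mult_right_mono) auto
      ultimately show ?thesis
        by simp
    qed
    then show ?thesis
      using nonneg_le_small_mult_imp_0 [of "cmod (cinner d f)"] norm_ge_zero norm_eq_zero by blast
  qed
  then show ?thesis
    by (simp add: orth_compl_def)
qed

text \<open>The two ranges work in tandem: one equation is solved with \<open>A - \<i>\<close>, and
  the vector \<open>u\<close> or \<open>g - u\<close> that must vanish is then written as
  \<open>(A + \<i>) w\<close>, which makes it orthogonal to itself.\<close>

lemma selfadjoint_inI:
  fixes A :: "('a::complex_hilbert, 'a) operator"
  assumes A: "symmetric_operator A" "A \<subseteq> L \<times> L" and L: "csubspace L" "closed L"
    and range_i: "L \<subseteq> shifted_range A \<i>" and range_minus_i: "L \<subseteq> shifted_range A (- \<i>)"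
  shows "selfadjoint_in L A"
proof -
  note symD = symmetric_operatorD [OF A(1)]
  have "L \<subseteq> closure (Domain A)"
  proof
    fix x
    assume x: "x \<in> L"
    obtain p where p: "p \<in> closure (Domain A)" "x - p \<in> orth_compl (closure (Domain A))"
      using orthogonal_decomposition symD(1) csubspace_closure csubspace_Domain closed_closure
      by metis
    have "closure (Domain A) \<subseteq> L"
      using A(2) L(2) by (intro closure_minimal) auto
    then have "x - p \<in> L"
      using x p(1) L(1) csubspace_diff by blast
    then obtain u u' where u: "(u, u') \<in> A" "x - p = u' - \<i> *\<^sub>C u"
      using range_i by (blast elim: shifted_rangeE)
    obtain w w' where w: "(w, w') \<in> A" "u = w' - (- \<i>) *\<^sub>C w"
      using range_minus_i u(1) A(2) by (blast elim: shifted_rangeE)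
    have "cinner (x - p) w = 0"
      using p(2) w(1) closure_subset unfolding orth_compl_def by blast
    then have "cinner u (w' - (- \<i>) *\<^sub>C w) = 0"
      using symD(3) [OF u(1) w(1)] unfolding u(2) by (simp add: cinner_simps)
    then have "u = 0"
      using w(2) by simp
    moreover from this have "u' = 0"
      using symD(2) u(1) csubspace_PairD_0 [OF symD(1)] by (auto dest: single_valuedD)
    ultimately show "x \<in> closure (Domain A)"
      using u(2) p(1) by (simp add: scaleC.zero_right)
  qed
  moreover have "adjoint_in L A = A"
  proof
    show "A \<subseteq> adjoint_in L A"
      using A(2) symD(3) by (auto simp: adjoint_in_def)
    show "adjoint_in L A \<subseteq> A"
    proof (rule subrelI)
      fix g g'
      assume "(g, g') \<in> adjoint_in L A"
      then have g: "g \<in> L" "g' \<in> L" and adj: "\<And>f f'. (f, f') \<in> A \<Longrightarrow> cinner f' g = cinner f g'"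
        by (auto simp: adjoint_in_def)
      have "g' - \<i> *\<^sub>C g \<in> L"
        using g L(1) by (simp add: csubspace_diff complex_vector.subspace_scale)
      then obtain u u' where u: "(u, u') \<in> A" "g' - \<i> *\<^sub>C g = u' - \<i> *\<^sub>C u"
        using range_i by (blast elim: shifted_rangeE)
      then have "g - u \<in> L"
        using g A(2) L(1) csubspace_diff by blast
      then obtain w w' where w: "(w, w') \<in> A" "g - u = w' - (- \<i>) *\<^sub>C w"
        using range_minus_i by (blast elim: shifted_rangeE)
      \<comment> \<open>Subtracting \<open>(u, u')\<close> leaves an eigenvector
        \<open>g - u\<close> of the adjoint at \<open>\<i>\<close>; it is orthogonal to the range of
        \<open>A + \<i>\<close>, to which it also belongs.\<close>
      have eq: "g' - u' = \<i> *\<^sub>C (g - u)"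
        using u(2) by (simp add: scaleC.diff_right algebra_simps)
      have "cinner (w' - (- \<i>) *\<^sub>C w) (g - u) = cinner w (g' - u') + \<i> * cinner w (g - u)"
        using adj [OF w(1)] symD(3) [OF w(1) u(1)] by (simp add: cinner_simps algebra_simps)
      also have "\<dots> = 0"
        unfolding eq by (simp add: cinner_scaleC_right)
      finally have "g = u"
        using w(2) by simp
      with eq u(1) show "(g, g') \<in> A"
        by (simp add: scaleC.zero_right)
    qed
  qed
  ultimately show ?thesis
    using A by (simp add: selfadjoint_in_def densely_defined_in_def symmetric_operator_def)
qed

section \<open>Simple operators\<close>

text \<open>
  The vectors orthogonal to all defect spaces form a reducing subspace on which the operator is
  self-adjoint, because this subspace is invariant under the inverses of all \<open>A - z\<close>.
\<close>

lemma simple_operator_orth_compl_defect_spaces: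
  fixes A :: "('a::complex_hilbert, 'a) operator"
  assumes A: "symmetric_operator A" "closed A" and simple: "simple_operator A"
  shows "orth_compl (\<Union>z\<in>- \<real>. defect_space A z) = {0}"
proof -
  note symD = symmetric_operatorD [OF A(1)]
  define L where "L = orth_compl (\<Union>z\<in>- \<real>. defect_space A z)"
  define A\<^sub>L where "A\<^sub>L = A \<inter> L \<times> L"
  have L: "csubspace L" "closed L"
    by (simp_all add: L_def csubspace_orth_compl closed_orth_compl)
  have L_iff: "x \<in> L \<longleftrightarrow> (\<forall>w. w \<notin> \<real> \<longrightarrow> x \<in> orth_compl (defect_space A w))" for x
    by (auto simp: L_def orth_compl_def)
  have range: "L \<subseteq> shifted_range A\<^sub>L z" if z: "z \<notin> \<real>" for z
  proof
    fix f
    assume f: "f \<in> L"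
    \<comment> \<open>The elements of \<open>L\<close> are exactly the vectors in the range of
      \<open>A - cnj w\<close> for every nonreal \<open>w\<close>.\<close>
    have f_range: "f \<in> shifted_range A (cnj w)" if "w \<notin> \<real>" for w
      using f L_iff shifted_range_eq [OF A Reals_cnj_notin [OF that]] that by simp
    obtain u u' where u: "(u, u') \<in> A" "f = u' - z *\<^sub>C u"
      using f_range [OF Reals_cnj_notin [OF z]] by (auto elim: shifted_rangeE)
    \<comment> \<open>A form of the resolvent identity: \<open>A - cnj w\<close> sends
      \<open>u - v\<close> to \<open>(z - cnj w) u\<close>, so \<open>u\<close> itself lies in the
      range once \<open>w \<noteq> cnj z\<close>. The excluded point is reached by a limit.\<close>
    have generic: "u \<in> orth_compl (defect_space A w)" if w: "w \<notin> \<real>" "w \<noteq> cnj z" for w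
    proof -
      obtain v v' where v: "(v, v') \<in> A" "f = v' - cnj w *\<^sub>C v"
        using f_range [OF w(1)] by (auto elim: shifted_rangeE)
      have "(u - v, u' - v') \<in> A"
        by (rule csubspace_PairD_diff [OF symD(1) u(1) v(1)])
      then have "(u' - v') - cnj w *\<^sub>C (u - v) \<in> shifted_range A (cnj w)"
        by (rule shifted_rangeI)
      also have "(u' - v') - cnj w *\<^sub>C (u - v) = (z - cnj w) *\<^sub>C u"
        using u(2) v(2) by (simp add: scaleC.diff_right scaleC.diff_left algebra_simps)
      finally have "(1 / (z - cnj w)) *\<^sub>C ((z - cnj w) *\<^sub>C u) \<in> shifted_range A (cnj w)"
        by (rule complex_vector.subspace_scale [OF csubspace_shifted_range [OF symD(1)]])
      moreover have "z - cnj w \<noteq> 0"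
        using w(2) by auto
      ultimately have "u \<in> shifted_range A (cnj w)"
        by (simp add: complex_vector.scale_one)
      then show ?thesis
        using shifted_range_eq [OF A Reals_cnj_notin [OF w(1)]] by simp
    qed
    moreover have "u \<in> orth_compl (defect_space A (cnj z))"
      using orth_compl_defect_space_limit [OF A Reals_cnj_notin [OF z]] generic by blast
    ultimately have "u \<in> L"
      unfolding L_iff by metis
    moreover have "u' = f + z *\<^sub>C u"
      by (simp add: u(2))
    then have "u' \<in> L"
      using f \<open>u \<in> L\<close> L(1)
      by (simp add: complex_vector.subspace_add complex_vector.subspace_scale)
    ultimately show "f \<in> shifted_range A\<^sub>L z"
      using u by (auto simp: A\<^sub>L_def intro!: shifted_rangeI)
  qed
  have "symmetric_operator A\<^sub>L"
    using A(1) csubspace_Times [OF L(1) L(1)] complex_vector.subspace_inter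
    by (auto simp: symmetric_operator_def linear_operator_def A\<^sub>L_def single_valued_def)
  then have selfadjoint: "selfadjoint_in L A\<^sub>L"
    by (rule selfadjoint_inI) (use L range in \<open>auto simp: A\<^sub>L_def complex_is_Real_iff\<close>)
  have "(orth_proj L f, orth_proj L f') \<in> A" if f: "(f, f') \<in> A" for f f'
  proof -
    have "cinner g' (orth_proj L f) = cinner g (orth_proj L f')" if "(g, g') \<in> A\<^sub>L" for g g'
      using that symD(3) [OF _ f, of g g'] by (simp add: A\<^sub>L_def cinner_orth_proj [OF L])
    then have "(orth_proj L f, orth_proj L f') \<in> adjoint_in L A\<^sub>L"
      by (auto simp: adjoint_in_def orth_proj_in [OF L])
    then show ?thesis
      using selfadjoint by (simp add: selfadjoint_in_def A\<^sub>L_def)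
  qed
  then have "reducing_subspace A L"
    using L by (auto simp: reducing_subspace_def)
  then have "L = {0}"
    using simple selfadjoint by (auto simp: simple_operator_def A\<^sub>L_def)
  then show ?thesis
    by (simp add: L_def)
qed

text \<open>The condition at \<open>\<i>\<close> alone yields \<open>(v, v') \<in> A\<close> with
  \<open>v' + \<i> *\<^sub>C v = u' + \<i> *\<^sub>C u\<close>. The conditions at the other points
  make \<open>u - v\<close> orthogonal to those defect spaces, a limit covers \<open>\<i>\<close>,
  and simplicity leaves \<open>u = v\<close>.\<close>

lemma simple_operator_mem_iff:
  fixes A :: "('a::complex_hilbert, 'a) operator"
  assumes A: "symmetric_operator A" "closed A" and simple: "simple_operator A"
  shows "(u, u') \<in> A \<longleftrightarrow> (\<forall>z f. z \<notin> \<real> \<longrightarrow> f \<in> defect_space A z \<longrightarrow> cinner u' f = cinner u (z *\<^sub>C f))"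
    (is "_ \<longleftrightarrow> ?orth u u'")
proof
  assume "(u, u') \<in> A"
  then show "?orth u u'"
    by (auto simp: defect_space_def adjoint_iff)
next
  assume u: "?orth u u'"
  have "cinner (u' - (- \<i>) *\<^sub>C u) f = 0" if "f \<in> defect_space A \<i>" for f
    using spec [OF u, of \<i>] that by (simp add: cinner_simps complex_is_Real_iff)
  then have "u' - (- \<i>) *\<^sub>C u \<in> shifted_range A (- \<i>)"
    by (simp add: shifted_range_eq [OF A] complex_is_Real_iff orth_compl_def)
  then obtain v v' where v: "(v, v') \<in> A" "u' - (- \<i>) *\<^sub>C u = v' - (- \<i>) *\<^sub>C v"
    by (rule shifted_rangeE)
  have eq: "u' - v' = (- \<i>) *\<^sub>C (u - v)"
    using v(2) by (simp add: scaleC.diff_right scaleC.minus_left algebra_simps)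
  have generic: "u - v \<in> orth_compl (defect_space A w)" if w: "w \<notin> \<real>" "w \<noteq> \<i>" for w
  proof -
    have "cinner (u - v) f = 0" if f: "f \<in> defect_space A w" for f
    proof -
      have "cinner v' f = cinner v (w *\<^sub>C f)"
        using f v(1) by (simp add: defect_space_def adjoint_iff)
      then have "cinner (u' - v') f = cinner (u - v) (w *\<^sub>C f)"
        using u w(1) f by (simp add: cinner_simps right_diff_distrib)
      then have "(cnj w - (- \<i>)) * cinner (u - v) f = 0"
        unfolding eq cinner_scaleC_left cinner_scaleC_right ring_distribs
        by (metis add.right_inverse add_uminus_conv_diff diff_minus_eq_add mult_minus_left)
      moreover have "cnj w - (- \<i>) \<noteq> 0"
        using w(2) by (metis complex_cnj_cnj complex_cnj_i complex_cnj_minus eq_iff_diff_eq_0 minus_minus)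
      ultimately show ?thesis
        by (simp only: mult_eq_0_iff simp_thms)
    qed
    then show ?thesis
      by (simp add: orth_compl_def)
  qed
  have "u - v \<in> orth_compl (defect_space A \<i>)"
    using orth_compl_defect_space_limit [OF A, of \<i> "u - v"] generic
    by (simp add: complex_is_Real_iff)
  then have "u - v \<in> orth_compl (\<Union>z\<in>- \<real>. defect_space A z)"
    using generic unfolding orth_compl_def by auto
  then have "u = v"
    using simple_operator_orth_compl_defect_spaces [OF A simple] by simp
  with eq v(1) show "(u, u') \<in> A"
    by (simp add: scaleC.zero_right)
qed

section \<open>Boundary triplets\<close>

lemma clinear_onD:
  assumes "clinear_on S T"
  shows "x \<in> S \<Longrightarrow> y \<in> S \<Longrightarrow> T (x + y) = T x + T y"
    and "x \<in> S \<Longrightarrow> T (c *\<^sub>C x) = c *\<^sub>C T x"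
  using assms by (auto simp: clinear_on_def)

lemma clinear_on_diff:
  assumes "clinear_on S T" "csubspace S" "x \<in> S" "y \<in> S"
  shows "T (x - y) = T x - T y"
proof -
  have "T x = T ((x - y) + y)"
    by simp
  also have "\<dots> = T (x - y) + T y"
    using assms csubspace_diff by (intro clinear_onD) auto
  finally show ?thesis
    by simp
qed

locale boundary_triplet_operator =
  fixes A :: "('a::complex_hilbert, 'a) operator"
    and H :: "'h::complex_hilbert set" and \<Gamma>\<^sub>0 \<Gamma>\<^sub>1 :: "'a \<Rightarrow> 'h"
  assumes symmetric: "symmetric_operator A" and closed: "closed A"
    and dense: "densely_defined A" and triplet: "boundary_triplet A H \<Gamma>\<^sub>0 \<Gamma>\<^sub>1"
begin

lemma
  shows H: "csubspace H" "closed H"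
    and linear: "clinear_on (Domain (adjoint A)) \<Gamma>\<^sub>0" "clinear_on (Domain (adjoint A)) \<Gamma>\<^sub>1"
    and image: "(\<lambda>f. (\<Gamma>\<^sub>1 f, \<Gamma>\<^sub>0 f)) ` Domain (adjoint A) = H \<times> H"
  using triplet by (auto simp: boundary_triplet_def)

lemma green:
  assumes "(f, f') \<in> adjoint A" "(g, g') \<in> adjoint A"
  shows "cinner f' g - cinner f g' = cinner (\<Gamma>\<^sub>1 f) (\<Gamma>\<^sub>0 g) - cinner (\<Gamma>\<^sub>0 f) (\<Gamma>\<^sub>1 g)"
  using triplet assms unfolding boundary_triplet_def by fast

lemma boundary_values_in:
  assumes "(f, f') \<in> adjoint A"
  shows "\<Gamma>\<^sub>0 f \<in> H" "\<Gamma>\<^sub>1 f \<in> H"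
  using image assms by (auto simp: set_eq_iff image_iff)

lemma obtain_boundary_values:
  assumes "h \<in> H" "k \<in> H"
  obtains f f' where "(f, f') \<in> adjoint A" "\<Gamma>\<^sub>0 f = h" "\<Gamma>\<^sub>1 f = k"
proof -
  have "(k, h) \<in> (\<lambda>f. (\<Gamma>\<^sub>1 f, \<Gamma>\<^sub>0 f)) ` Domain (adjoint A)"
    using assms by (simp add: image)
  then show thesis
    using that by auto
qed

lemma boundary_diff:
  assumes "(f, f') \<in> adjoint A" "(g, g') \<in> adjoint A"
  shows "\<Gamma>\<^sub>0 (f - g) = \<Gamma>\<^sub>0 f - \<Gamma>\<^sub>0 g"
  using assms by (intro clinear_on_diff [OF linear(1) csubspace_Domain [OF csubspace_adjoint]]) auto

text \<open>Surjectivity provides a test vector \<open>g\<close> with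
  \<open>\<Gamma>\<^sub>0 g = 0\<close> and \<open>\<Gamma>\<^sub>1 g = \<Gamma>\<^sub>0 f\<close>.
  The left side of Green's identity vanishes, as \<open>f\<close> is in the domain of
  \<open>A\<close>, and the right side is minus the squared norm of
  \<open>\<Gamma>\<^sub>0 f\<close>.\<close>

lemma boundary_values_eq_0:
  assumes "(f, f') \<in> A"
  shows "\<Gamma>\<^sub>0 f = 0"
proof -
  have f: "(f, f') \<in> adjoint A"
    using assms symmetric_subset_adjoint [OF symmetric] by blast
  obtain g g' where g: "(g, g') \<in> adjoint A" "\<Gamma>\<^sub>0 g = 0" "\<Gamma>\<^sub>1 g = \<Gamma>\<^sub>0 f"
    using obtain_boundary_values [OF complex_vector.subspace_0 [OF H(1)] boundary_values_in(1) [OF f]] .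
  have "cinner f' g - cinner f g' = 0"
    using g(1) assms by (simp add: adjoint_iff)
  then show ?thesis
    using green [OF f g(1)] g by (simp add: cinner.zero_right)
qed

lemma csubspace_kernel_extension: "csubspace (kernel_extension A \<Gamma>\<^sub>0)"
  using csubspace_PairD_add [OF csubspace_adjoint, of _ _ A]
    csubspace_PairD_scale [OF csubspace_adjoint, of _ _ A]
    csubspace_PairD_0 [OF csubspace_adjoint, of A] boundary_values_eq_0
    csubspace_PairD_0 [OF symmetric_operatorD(1) [OF symmetric]]
  by (intro complex_vector.subspaceI)
    (auto simp: kernel_extension_def clinear_onD [OF linear(1)] DomainI zero_prod_def
      scaleC_prod_def scaleC.zero_right)

text \<open>Where \<open>\<Gamma>\<^sub>0\<close> vanishes, so does the right side of Green's
  identity, which gives one inclusion. For the other, \<open>g\<close> is tested against some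
  \<open>f\<close> with \<open>\<Gamma>\<^sub>0 f = 0\<close> and
  \<open>\<Gamma>\<^sub>1 f = \<Gamma>\<^sub>0 g\<close>.\<close>

lemma adjoint_kernel_extension: "adjoint (kernel_extension A \<Gamma>\<^sub>0) = kernel_extension A \<Gamma>\<^sub>0"
proof
  show "kernel_extension A \<Gamma>\<^sub>0 \<subseteq> adjoint (kernel_extension A \<Gamma>\<^sub>0)"
  proof (rule subrelI)
    fix g g'
    assume g: "(g, g') \<in> kernel_extension A \<Gamma>\<^sub>0"
    have "cinner f' g = cinner f g'" if f: "(f, f') \<in> kernel_extension A \<Gamma>\<^sub>0" for f f'
      using green [of f f' g g'] f g
      by (simp add: kernel_extension_def cinner.zero_left cinner.zero_right)
    then show "(g, g') \<in> adjoint (kernel_extension A \<Gamma>\<^sub>0)"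
      by (simp add: adjoint_iff)
  qed
  show "adjoint (kernel_extension A \<Gamma>\<^sub>0) \<subseteq> kernel_extension A \<Gamma>\<^sub>0"
  proof (rule subrelI)
    fix g g'
    assume g: "(g, g') \<in> adjoint (kernel_extension A \<Gamma>\<^sub>0)"
    have "A \<subseteq> kernel_extension A \<Gamma>\<^sub>0"
      using symmetric_subset_adjoint [OF symmetric] boundary_values_eq_0
      by (auto simp: kernel_extension_def)
    then have g_adj: "(g, g') \<in> adjoint A"
      using g adjoint_antimono by blast
    obtain f f' where f: "(f, f') \<in> adjoint A" "\<Gamma>\<^sub>0 f = 0" "\<Gamma>\<^sub>1 f = \<Gamma>\<^sub>0 g"
      using obtain_boundary_values [OF complex_vector.subspace_0 [OF H(1)] boundary_values_in(1) [OF g_adj]] .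
    then have "cinner f' g = cinner f g'"
      using g by (simp add: adjoint_iff kernel_extension_def)
    then have "\<Gamma>\<^sub>0 g = 0"
      using green [OF f(1) g_adj] f by (simp add: cinner.zero_left)
    then show "(g, g') \<in> kernel_extension A \<Gamma>\<^sub>0"
      using g_adj by (simp add: kernel_extension_def)
  qed
qed

lemma symmetric_kernel_extension: "symmetric_operator (kernel_extension A \<Gamma>\<^sub>0)"
proof -
  have "single_valued (kernel_extension A \<Gamma>\<^sub>0)"
    by (rule single_valued_subset [OF _ single_valued_adjoint [OF dense]])
      (auto simp: kernel_extension_def)
  moreover have "cinner f' g = cinner f g'"
    if "(f, f') \<in> kernel_extension A \<Gamma>\<^sub>0" "(g, g') \<in> kernel_extension A \<Gamma>\<^sub>0" for f f' g g'
    using that adjoint_kernel_extension by (metis adjoint_iff)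
  ultimately show ?thesis
    using csubspace_kernel_extension by (auto simp: symmetric_operator_def linear_operator_def)
qed

text \<open>By self-adjointness a defect vector is an eigenvector of a symmetric operator, which the
  lower bound excludes at nonreal points; the range is closed and has trivial complement.\<close>

lemma shifted_range_kernel_extension:
  assumes z: "z \<notin> \<real>"
  shows "shifted_range (kernel_extension A \<Gamma>\<^sub>0) z = UNIV"
proof -
  have "defect_space (kernel_extension A \<Gamma>\<^sub>0) (cnj z) \<subseteq> {0}"
  proof
    fix f
    assume "f \<in> defect_space (kernel_extension A \<Gamma>\<^sub>0) (cnj z)"
    then have "(f, cnj z *\<^sub>C f) \<in> kernel_extension A \<Gamma>\<^sub>0"
      by (simp add: defect_space_def adjoint_kernel_extension)
    then show "f \<in> {0}"
      using symmetric_lower_bound [OF symmetric_kernel_extension, of f "cnj z *\<^sub>C f" "cnj z"] z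
      by (simp add: complex_is_Real_iff mult_le_0_iff)
  qed
  then have "defect_space (kernel_extension A \<Gamma>\<^sub>0) (cnj z) = {0}"
    using complex_vector.subspace_0 [OF csubspace_defect_space] by blast
  moreover have "closed (kernel_extension A \<Gamma>\<^sub>0)"
    using closed_adjoint adjoint_kernel_extension by metis
  ultimately show ?thesis
    using shifted_range_eq [OF symmetric_kernel_extension _ z] by (simp add: orth_compl_zero)
qed

text \<open>From any \<open>f\<close> in the domain of the adjoint with boundary value
  \<open>h\<close>, the solution \<open>u\<close> of
  \<open>(A\<^sub>0 - z) u = (A\<^sup>* - z) f\<close> is subtracted. The difference is a defect
  vector, and \<open>\<Gamma>\<^sub>0 u = 0\<close> preserves the boundary value.\<close>

lemma defect_space_boundary_value:
  assumes z: "z \<notin> \<real>" and h: "h \<in> H"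
  obtains f where "f \<in> defect_space A z" "\<Gamma>\<^sub>0 f = h"
proof -
  obtain f f' where f: "(f, f') \<in> adjoint A" "\<Gamma>\<^sub>0 f = h"
    using obtain_boundary_values [OF h h] by metis
  have "f' - z *\<^sub>C f \<in> shifted_range (kernel_extension A \<Gamma>\<^sub>0) z"
    by (simp add: shifted_range_kernel_extension [OF z])
  then obtain u u' where u: "(u, u') \<in> kernel_extension A \<Gamma>\<^sub>0" "f' - z *\<^sub>C f = u' - z *\<^sub>C u"
    by (rule shifted_rangeE)
  then have u_adj: "(u, u') \<in> adjoint A" "\<Gamma>\<^sub>0 u = 0"
    by (auto simp: kernel_extension_def)
  have "f' - u' = z *\<^sub>C (f - u)"
    using u(2) by (simp add: scaleC.diff_right algebra_simps)
  then have "f - u \<in> defect_space A z"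
    using csubspace_PairD_diff [OF csubspace_adjoint f(1) u_adj(1)] by (simp add: defect_space_def)
  moreover have "\<Gamma>\<^sub>0 (f - u) = h"
    using boundary_diff [OF f(1) u_adj(1)] f(2) u_adj(2) by simp
  ultimately show thesis
    using that by blast
qed

text \<open>If \<open>\<Gamma>\<^sub>0 f = \<Gamma>\<^sub>0 g\<close> then \<open>g - f\<close> lies in the domain of the symmetric operator \<open>A\<^sub>0\<close>.\<close>

lemma defect_space_dist_le:
  assumes f: "f \<in> defect_space A z" and g: "g \<in> defect_space A w" and eq: "\<Gamma>\<^sub>0 g = \<Gamma>\<^sub>0 f"
  shows "\<bar>Im w\<bar> * norm (g - f) \<le> cmod (w - z) * norm f"
proof -
  have adj: "(f, z *\<^sub>C f) \<in> adjoint A" "(g, w *\<^sub>C g) \<in> adjoint A"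
    using f g by (auto simp: defect_space_def)
  then have "(g - f, w *\<^sub>C g - z *\<^sub>C f) \<in> kernel_extension A \<Gamma>\<^sub>0"
    using csubspace_PairD_diff [OF csubspace_adjoint adj(2) adj(1)] boundary_diff [OF adj(2) adj(1)] eq
    by (simp add: kernel_extension_def)
  then have "\<bar>Im w\<bar> * norm (g - f) \<le> norm (w *\<^sub>C g - z *\<^sub>C f - w *\<^sub>C (g - f))"
    by (rule symmetric_lower_bound [OF symmetric_kernel_extension])
  also have "w *\<^sub>C g - z *\<^sub>C f - w *\<^sub>C (g - f) = (w - z) *\<^sub>C f"
    by (simp add: scaleC.diff_right scaleC.diff_left)
  finally show ?thesis
    by (simp add: norm_scaleC)
qed

lemma green_defect_spaces:
  assumes "f \<in> defect_space A z" "g \<in> defect_space A w"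
  shows "(z - cnj w) * cinner f g = cinner (\<Gamma>\<^sub>1 f) (\<Gamma>\<^sub>0 g) - cinner (\<Gamma>\<^sub>0 f) (\<Gamma>\<^sub>1 g)"
  using green [of f "z *\<^sub>C f" g "w *\<^sub>C g"] assms
  by (simp add: defect_space_def cinner_simps left_diff_distrib)

end

section \<open>Unitary operators and the comparison of two boundary triplets\<close>

lemma unitaryD:
  assumes "unitary U"
  shows "U (x + y) = U x + U y" "U (c *\<^sub>C x) = c *\<^sub>C U x" "bij U" "cinner (U x) (U y) = cinner x y"
proof -
  interpret Vector_Spaces.linear scaleC scaleC U
    using assms by (simp add: unitary_def)
  show "U (x + y) = U x + U y" "U (c *\<^sub>C x) = c *\<^sub>C U x"
    by (rule add scale)+
  show "bij U" "cinner (U x) (U y) = cinner x y"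
    using assms by (simp_all add: unitary_def)
qed

lemma map_prod_image_eqI:
  assumes "bij U" "\<And>u u'. (u, u') \<in> A \<longleftrightarrow> (U u, U u') \<in> B"
  shows "B = map_prod U U ` A"
proof (intro set_eqI iffI)
  fix p
  assume "p \<in> B"
  moreover obtain u u' where "p = (U u, U u')"
    using bij_is_surj [OF assms(1)] by (metis surj_pair surjD)
  ultimately show "p \<in> map_prod U U ` A"
    using assms(2) by force
qed (use assms(2) in auto)

lemma adjoint_map_prod:
  assumes U: "unitary U" and B: "B = map_prod U U ` A"
  shows "(U u, U u') \<in> adjoint B \<longleftrightarrow> (u, u') \<in> adjoint A"
  by (simp add: adjoint_in_def B split_beta unitaryD [OF U])

lemma same_weyl_function_cinner_eq:
  assumes "boundary_triplet_operator A H \<Gamma>\<^sub>0 \<Gamma>\<^sub>1" and "boundary_triplet_operator B H \<Delta>\<^sub>0 \<Delta>\<^sub>1"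
    and weyl: "\<And>z. z \<notin> \<real> \<Longrightarrow> weyl_function A \<Gamma>\<^sub>0 \<Gamma>\<^sub>1 z = weyl_function B \<Delta>\<^sub>0 \<Delta>\<^sub>1 z"
    and z: "z \<notin> \<real>" "f \<in> defect_space A z" "g \<in> defect_space B z"
      "\<Gamma>\<^sub>0 f = \<Delta>\<^sub>0 g" "\<Gamma>\<^sub>1 f = \<Delta>\<^sub>1 g"
    and w: "w \<notin> \<real>" "f' \<in> defect_space A w" "g' \<in> defect_space B w"
      "\<Gamma>\<^sub>0 f' = \<Delta>\<^sub>0 g'" "\<Gamma>\<^sub>1 f' = \<Delta>\<^sub>1 g'"
  shows "cinner f f' = cinner g g'"
proof -
  interpret A: boundary_triplet_operator A H \<Gamma>\<^sub>0 \<Gamma>\<^sub>1 by fact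
  interpret B: boundary_triplet_operator B H \<Delta>\<^sub>0 \<Delta>\<^sub>1 by fact
  have generic: "cinner f k = cinner g l"
    if "z \<noteq> cnj w'" "k \<in> defect_space A w'" "l \<in> defect_space B w'" "\<Gamma>\<^sub>0 k = \<Delta>\<^sub>0 l" "\<Gamma>\<^sub>1 k = \<Delta>\<^sub>1 l"
    for w' k l
  proof -
    have "(z - cnj w') * cinner f k = (z - cnj w') * cinner g l"
      unfolding A.green_defect_spaces [OF z(2) that(2)] B.green_defect_spaces [OF z(3) that(3)]
      by (simp add: z that)
    then show ?thesis
      using that(1) by simp
  qed
  show ?thesis
  proof (cases "z = cnj w")
    case False
    then show ?thesis
      using generic w by blast
  next
    case True
    have Im: "\<bar>Im w\<bar> > 0"
      using w(1) by (simp add: complex_is_Real_iff)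
    have "cmod (cinner f f' - cinner g g') \<le>
        t * ((norm f * norm f' + norm g * norm g') / \<bar>Im w\<bar>)" if t: "t > 0" for t
    proof -
      define w' where "w' = w + complex_of_real t"
      have w': "w' \<notin> \<real>" "z \<noteq> cnj w'" "Im w' = Im w" "w' - w = complex_of_real t"
        using real_shift_notin [OF w(1)] t by (auto simp: w'_def True)
      have "(f', w *\<^sub>C f') \<in> adjoint A"
        using w(2) by (simp add: defect_space_def)
      \<comment> \<open>Here \<open>k\<close> and, through the equal Weyl functions,
        \<open>l\<close> take the place of \<open>f'\<close> and \<open>g'\<close> at the shifted
        point \<open>w'\<close>, where Green's identity can be divided. Equal values of the first
        boundary maps keep them within a multiple of \<open>t\<close> of \<open>f'\<close> and
        \<open>g'\<close>.\<close>
      then obtain k where k: "k \<in> defect_space A w'" "\<Gamma>\<^sub>0 k = \<Gamma>\<^sub>0 f'"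
        using A.defect_space_boundary_value [OF w'(1) A.boundary_values_in(1)] by metis
      then have "(\<Gamma>\<^sub>0 k, \<Gamma>\<^sub>1 k) \<in> weyl_function A \<Gamma>\<^sub>0 \<Gamma>\<^sub>1 w'"
        unfolding weyl_function_def by blast
      then have "(\<Gamma>\<^sub>0 k, \<Gamma>\<^sub>1 k) \<in> weyl_function B \<Delta>\<^sub>0 \<Delta>\<^sub>1 w'"
        by (simp only: weyl [OF w'(1)])
      then obtain l where l: "l \<in> defect_space B w'" "\<Gamma>\<^sub>0 k = \<Delta>\<^sub>0 l" "\<Gamma>\<^sub>1 k = \<Delta>\<^sub>1 l"
        by (auto simp: weyl_function_def)
      have "cinner f k = cinner g l"
        by (rule generic [OF w'(2) k(1) l])
      then have "cinner f f' - cinner g g' = cinner g (l - g') - cinner f (k - f')"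
        by (simp add: cinner_simps)
      also have "cmod \<dots> \<le> norm g * norm (l - g') + norm f * norm (k - f')"
        by (rule order_trans [OF norm_triangle_ineq4 add_mono [OF norm_cinner_le norm_cinner_le]])
      also have "\<dots> \<le> norm g * (t * norm g' / \<bar>Im w\<bar>) + norm f * (t * norm f' / \<bar>Im w\<bar>)"
        using A.defect_space_dist_le [OF w(2) k] B.defect_space_dist_le [OF w(3) l(1)] k l w(4) t Im w'
        by (intro add_mono mult_left_mono) (auto simp: pos_le_divide_eq mult.commute)
      also have "\<dots> = t * ((norm f * norm f' + norm g * norm g') / \<bar>Im w\<bar>)"
        by (simp add: add_divide_distrib algebra_simps)
      finally show ?thesis .
    qed
    then have "cmod (cinner f f' - cinner g g') = 0"
      by (rule nonneg_le_small_mult_imp_0 [OF norm_ge_zero])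
    then show ?thesis
      by simp
  qed
qed

text \<open>Passes from defect vectors to the whole domain of the adjoint, as needed for the
  extensions. Green's identity against all defect vectors ties together the discrepancies
  \<open>p\<close> and \<open>q\<close> of the boundary maps, and the points \<open>\<i>\<close> and
  \<open>- \<i>\<close> suffice to force \<open>q = 0\<close>.\<close>

lemma same_weyl_function_boundary_value_eq:
  assumes "boundary_triplet_operator A H \<Gamma>\<^sub>0 \<Gamma>\<^sub>1" and "boundary_triplet_operator B H \<Delta>\<^sub>0 \<Delta>\<^sub>1"
    and U: "unitary U"
    and U_defect: "\<And>z f. z \<notin> \<real> \<Longrightarrow> f \<in> defect_space A z \<Longrightarrow>
      U f \<in> defect_space B z \<and> \<Gamma>\<^sub>0 f = \<Delta>\<^sub>0 (U f) \<and> \<Gamma>\<^sub>1 f = \<Delta>\<^sub>1 (U f)"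
    and u: "(u, u') \<in> adjoint A" and Uu: "(U u, U u') \<in> adjoint B"
  shows "\<Gamma>\<^sub>0 u = \<Delta>\<^sub>0 (U u)"
proof -
  interpret A: boundary_triplet_operator A H \<Gamma>\<^sub>0 \<Gamma>\<^sub>1 by fact
  interpret B: boundary_triplet_operator B H \<Delta>\<^sub>0 \<Delta>\<^sub>1 by fact
  define p q where "p = \<Gamma>\<^sub>1 u - \<Delta>\<^sub>1 (U u)" and "q = \<Gamma>\<^sub>0 u - \<Delta>\<^sub>0 (U u)"
  have q: "q \<in> H"
    unfolding q_def by (intro csubspace_diff A.H A.boundary_values_in [OF u] B.boundary_values_in [OF Uu])
  have pq: "cinner p (\<Gamma>\<^sub>0 f) = cinner q (\<Gamma>\<^sub>1 f)" if z: "z \<notin> \<real>" and f: "f \<in> defect_space A z" for z f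
  proof -
    have adj: "(f, z *\<^sub>C f) \<in> adjoint A" "(U f, z *\<^sub>C U f) \<in> adjoint B"
      using f U_defect [OF z f] by (auto simp: defect_space_def)
    have "cinner u' f - cinner u (z *\<^sub>C f) = cinner (U u') (U f) - cinner (U u) (z *\<^sub>C U f)"
      by (simp add: unitaryD [OF U] cinner_scaleC_right)
    then have "cinner (\<Gamma>\<^sub>1 u) (\<Gamma>\<^sub>0 f) - cinner (\<Gamma>\<^sub>0 u) (\<Gamma>\<^sub>1 f) =
        cinner (\<Delta>\<^sub>1 (U u)) (\<Gamma>\<^sub>0 f) - cinner (\<Delta>\<^sub>0 (U u)) (\<Gamma>\<^sub>1 f)"
      unfolding A.green [OF u adj(1)] B.green [OF Uu adj(2)] using U_defect [OF z f] by simp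
    then show ?thesis
      by (simp add: p_def q_def cinner.diff_left algebra_simps)
  qed
  \<comment> \<open>Since \<open>\<i> = cnj (- \<i>)\<close>, the left side of Green's identity for
    \<open>f\<close> and \<open>g\<close> is zero. Together with \<open>pq\<close> this shows
    \<open>(\<Gamma>\<^sub>1 f, q) = (q, \<Gamma>\<^sub>1 f)\<close>, and Green's identity for
    \<open>f\<close> with itself becomes \<open>2 \<i> (f, f) = 0\<close>.\<close>
  obtain f where f: "f \<in> defect_space A \<i>" "\<Gamma>\<^sub>0 f = q"
    using A.defect_space_boundary_value [OF _ q, of \<i>] by (auto simp: complex_is_Real_iff)
  obtain g where g: "g \<in> defect_space A (- \<i>)" "\<Gamma>\<^sub>0 g = q"
    using A.defect_space_boundary_value [OF _ q, of "- \<i>"] by (auto simp: complex_is_Real_iff)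
  have "cinner q (\<Gamma>\<^sub>1 f) = cinner q (\<Gamma>\<^sub>1 g)"
    using pq [OF _ f(1)] pq [OF _ g(1)] f(2) g(2) by (simp add: complex_is_Real_iff)
  moreover have "cinner (\<Gamma>\<^sub>1 f) q = cinner q (\<Gamma>\<^sub>1 g)"
    using A.green_defect_spaces [OF f(1) g(1)] f(2) g(2) by simp
  ultimately have "cinner f f = 0"
    using A.green_defect_spaces [OF f(1) f(1)] f(2) by simp
  then have "f = 0"
    by simp
  then have "q = 0"
    using f(2) A.boundary_values_eq_0 csubspace_PairD_0 [OF symmetric_operatorD(1) [OF A.symmetric]]
    by blast
  then show ?thesis
    by (simp add: q_def)
qed

theorem same_weyl_function_unitarily_equivalent:
  assumes A: "boundary_triplet_operator A H \<Gamma>\<^sub>0 \<Gamma>\<^sub>1" "simple_operator A"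
    and B: "boundary_triplet_operator B H \<Delta>\<^sub>0 \<Delta>\<^sub>1" "simple_operator B"
    and weyl: "\<And>z. z \<notin> \<real> \<Longrightarrow> weyl_function A \<Gamma>\<^sub>0 \<Gamma>\<^sub>1 z = weyl_function B \<Delta>\<^sub>0 \<Delta>\<^sub>1 z"
  shows "unitarily_equivalent A B"
    and "unitarily_equivalent (kernel_extension A \<Gamma>\<^sub>0) (kernel_extension B \<Delta>\<^sub>0)"
proof -
  interpret A: boundary_triplet_operator A H \<Gamma>\<^sub>0 \<Gamma>\<^sub>1 by fact
  interpret B: boundary_triplet_operator B H \<Delta>\<^sub>0 \<Delta>\<^sub>1 by fact
  \<comment> \<open>\<open>S\<close> is merely a relation; the Gram identity makes it single-valued
    and lets it extend linearly.\<close>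
  define S where "S = {(f, g). \<exists>z. z \<notin> \<real> \<and> f \<in> defect_space A z \<and> g \<in> defect_space B z \<and>
    \<Gamma>\<^sub>0 f = \<Delta>\<^sub>0 g \<and> \<Gamma>\<^sub>1 f = \<Delta>\<^sub>1 g}"
  have gram: "cinner f f' = cinner g g'" if "(f, g) \<in> S" "(f', g') \<in> S" for f g f' g'
    using that same_weyl_function_cinner_eq [OF A(1) B(1) weyl] unfolding S_def by blast
  have left: "\<exists>g \<in> defect_space B z. \<Gamma>\<^sub>0 f = \<Delta>\<^sub>0 g \<and> \<Gamma>\<^sub>1 f = \<Delta>\<^sub>1 g"
    if "z \<notin> \<real>" "f \<in> defect_space A z" for z f
    using weyl [OF that(1)] that(2) by (auto simp: weyl_function_def set_eq_iff image_iff)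
  have right: "\<exists>f \<in> defect_space A z. \<Gamma>\<^sub>0 f = \<Delta>\<^sub>0 g \<and> \<Gamma>\<^sub>1 f = \<Delta>\<^sub>1 g"
    if "z \<notin> \<real>" "g \<in> defect_space B z" for z g
    using weyl [OF that(1)] that(2) by (auto simp: weyl_function_def set_eq_iff image_iff) metis
  have "Domain S = (\<Union>z\<in>- \<real>. defect_space A z)"
    using left by (fastforce simp: S_def)
  then have "closure (cspan (Domain S)) = UNIV"
    using closure_cspan_eq_UNIV
      simple_operator_orth_compl_defect_spaces [OF A.symmetric A.closed A(2)] by metis
  moreover have "Range S = (\<Union>z\<in>- \<real>. defect_space B z)"
    using right by (fastforce simp: S_def)
  then have "closure (cspan (Range S)) = UNIV"
    using closure_cspan_eq_UNIV
      simple_operator_orth_compl_defect_spaces [OF B.symmetric B.closed B(2)] by metis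
  ultimately obtain U where U: "unitary U" and U_S: "\<And>f g. (f, g) \<in> S \<Longrightarrow> U f = g"
    using isometric_extension_unitary gram by metis
  have U_defect: "U f \<in> defect_space B z \<and> \<Gamma>\<^sub>0 f = \<Delta>\<^sub>0 (U f) \<and> \<Gamma>\<^sub>1 f = \<Delta>\<^sub>1 (U f)"
    if z: "z \<notin> \<real>" and f: "f \<in> defect_space A z" for z f
  proof -
    obtain g where g: "g \<in> defect_space B z" "\<Gamma>\<^sub>0 f = \<Delta>\<^sub>0 g" "\<Gamma>\<^sub>1 f = \<Delta>\<^sub>1 g"
      using left [OF z f] by blast
    then have "U f = g"
      using z f by (intro U_S) (auto simp: S_def)
    with g show ?thesis
      by simp
  qed
  have U_onto: "\<exists>f \<in> defect_space A z. U f = g" if "z \<notin> \<real>" "g \<in> defect_space B z" for z g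
    using right [OF that] U_S that unfolding S_def by blast
  \<comment> \<open>Membership in either operator is tested on defect vectors alone, and
    \<open>U\<close> maps those of \<open>A\<close> onto those of \<open>B\<close>, preserving inner
    products.\<close>
  have "(u, u') \<in> A \<longleftrightarrow> (U u, U u') \<in> B" for u u'
  proof -
    have "cinner (U u') (U f) = cinner (U u) (z *\<^sub>C U f) \<longleftrightarrow> cinner u' f = cinner u (z *\<^sub>C f)" for z f
      by (simp add: unitaryD [OF U] cinner_scaleC_right)
    then show ?thesis
      unfolding simple_operator_mem_iff [OF A.symmetric A.closed A(2)]
        simple_operator_mem_iff [OF B.symmetric B.closed B(2)]
      using U_defect U_onto by metis
  qed
  then have map: "B = map_prod U U ` A"
    by (rule map_prod_image_eqI [OF unitaryD(3) [OF U]])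
  then show "unitarily_equivalent A B"
    using U unfolding unitarily_equivalent_def by blast
  have "(u, u') \<in> kernel_extension A \<Gamma>\<^sub>0 \<longleftrightarrow> (U u, U u') \<in> kernel_extension B \<Delta>\<^sub>0" for u u'
    using adjoint_map_prod [OF U map]
      same_weyl_function_boundary_value_eq [OF A(1) B(1) U U_defect, of u u']
    by (auto simp: kernel_extension_def)
  then have "kernel_extension B \<Delta>\<^sub>0 = map_prod U U ` kernel_extension A \<Gamma>\<^sub>0"
    by (rule map_prod_image_eqI [OF unitaryD(3) [OF U]])
  then show "unitarily_equivalent (kernel_extension A \<Gamma>\<^sub>0) (kernel_extension B \<Delta>\<^sub>0)"
    using U unfolding unitarily_equivalent_def by blast
qed

text \<open>\<open>U\<close> carries the adjoint of \<open>A\<close> to that of \<open>B\<close> and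
  each defect space to its counterpart. Composition with \<open>inv U\<close> gives \<open>f\<close>
  and \<open>U f\<close> the same boundary values, so the graphs of the Weyl functions
  coincide.\<close>

lemma boundary_triplet_unitary_transfer:
  fixes \<Gamma>\<^sub>0 \<Gamma>\<^sub>1 :: "'a::complex_hilbert \<Rightarrow> 'h::complex_hilbert"
  assumes triplet: "boundary_triplet A H \<Gamma>\<^sub>0 \<Gamma>\<^sub>1" and U: "unitary U" and B: "B = map_prod U U ` A"
  shows "triplets_with_same_weyl_function A B H \<Gamma>\<^sub>0 \<Gamma>\<^sub>1 (\<Gamma>\<^sub>0 \<circ> inv U) (\<Gamma>\<^sub>1 \<circ> inv U)"
proof -
  note bij = unitaryD(3) [OF U]
  have inv_U: "inv U (U x) = x" for x
    using bij by (simp add: bij_is_inj)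
  have adj: "adjoint B = map_prod U U ` adjoint A"
    using adjoint_map_prod [OF U B] by (intro map_prod_image_eqI [OF bij]) auto
  then have dom: "Domain (adjoint B) = U ` Domain (adjoint A)"
    by force
  have lin: "clinear_on (Domain (adjoint B)) (\<Gamma> \<circ> inv U)"
    if "clinear_on (Domain (adjoint A)) \<Gamma>" for \<Gamma> :: "'a \<Rightarrow> 'h"
    using that unfolding dom clinear_on_def
    by (simp add: inv_U flip: unitaryD(1,2) [OF U])
  have "boundary_triplet B H (\<Gamma>\<^sub>0 \<circ> inv U) (\<Gamma>\<^sub>1 \<circ> inv U)"
    unfolding boundary_triplet_def
  proof (intro conjI)
    show "csubspace H" "closed H"
      using triplet by (auto simp: boundary_triplet_def)
    show "clinear_on (Domain (adjoint B)) (\<Gamma>\<^sub>0 \<circ> inv U)" "clinear_on (Domain (adjoint B)) (\<Gamma>\<^sub>1 \<circ> inv U)"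
      using triplet by (auto simp: boundary_triplet_def intro!: lin)
    show "\<forall>(f, f')\<in>adjoint B. \<forall>(g, g')\<in>adjoint B. cinner f' g - cinner f g' =
        cinner ((\<Gamma>\<^sub>1 \<circ> inv U) f) ((\<Gamma>\<^sub>0 \<circ> inv U) g) - cinner ((\<Gamma>\<^sub>0 \<circ> inv U) f) ((\<Gamma>\<^sub>1 \<circ> inv U) g)"
      using triplet unfolding boundary_triplet_def adj
      by (simp add: split_beta inv_U unitaryD [OF U])
    show "(\<lambda>f. ((\<Gamma>\<^sub>1 \<circ> inv U) f, (\<Gamma>\<^sub>0 \<circ> inv U) f)) ` Domain (adjoint B) = H \<times> H"
      using triplet unfolding boundary_triplet_def dom by (simp add: image_image inv_U)
  qed
  moreover have "defect_space B z = U ` defect_space A z" for z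
  proof -
    have "U f \<in> defect_space B z \<longleftrightarrow> f \<in> defect_space A z" for f
      using adjoint_map_prod [OF U B, of f "z *\<^sub>C f"] by (simp add: defect_space_def unitaryD [OF U])
    then show ?thesis
      using bij_is_surj [OF bij] by (auto simp: set_eq_iff image_iff) (metis surjD)
  qed
  then have "weyl_function A \<Gamma>\<^sub>0 \<Gamma>\<^sub>1 z = weyl_function B (\<Gamma>\<^sub>0 \<circ> inv U) (\<Gamma>\<^sub>1 \<circ> inv U) z" for z
    by (simp add: weyl_function_def image_image inv_U)
  ultimately show ?thesis
    using triplet by (simp add: triplets_with_same_weyl_function_def)
qed

section \<open>Existence of boundary triplets\<close>

text \<open>Projecting \<open>(f, f')\<close> onto the closed graph of \<open>A\<close> leaves a
  pair \<open>(x, x')\<close> in the adjoint that is orthogonal to the graph. Orthogonality says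
  that \<open>(x', - x)\<close> is in the adjoint too, so the adjoint acts on the span of
  \<open>x\<close> and \<open>x'\<close> as a rotation with eigenvalues \<open>\<i>\<close> and
  \<open>- \<i>\<close>.\<close>

lemma von_Neumann_decomposition:
  fixes A :: "('a::complex_hilbert, 'a) operator"
  assumes A: "symmetric_operator A" "closed A" and f: "(f, f') \<in> adjoint A"
  obtains n m where "n \<in> defect_space A \<i>" "m \<in> defect_space A (- \<i>)"
    and "(f - n - m, f' - \<i> *\<^sub>C n + \<i> *\<^sub>C m) \<in> A"
proof -
  obtain a a' where a: "(a, a') \<in> A" and "(f, f') - (a, a') \<in> orth_compl A"
    using orthogonal_decomposition [OF symmetric_operatorD(1) [OF A(1)] A(2)] by (metis surj_pair)
  define x x' where "x = f - a" and "x' = f' - a'"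
  have x: "(x, x') \<in> adjoint A"
    using csubspace_PairD_diff [OF csubspace_adjoint f] a symmetric_subset_adjoint [OF A(1)]
    by (auto simp: x_def x'_def)
  have "cinner g' x' = cinner g (- x)" if "(g, g') \<in> A" for g g'
  proof -
    have "cinner (x, x') (g, g') = 0"
      using \<open>(f, f') - (a, a') \<in> orth_compl A\<close> that by (auto simp: orth_compl_def x_def x'_def)
    then have "cinner (g, g') (x, x') = 0"
      by (subst cinner_eq_0_sym)
    then show ?thesis
      by (simp add: cinner_prod_def cinner_simps add_eq_0_iff)
  qed
  then have x_rot: "(x', - x) \<in> adjoint A"
    by (simp add: adjoint_iff)
  \<comment> \<open>These are the components of \<open>x\<close> in the two eigenspaces of that
    rotation.\<close>
  define n m where "n = (1/2) *\<^sub>C (x - \<i> *\<^sub>C x')" and "m = (1/2) *\<^sub>C (x + \<i> *\<^sub>C x')"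
  have "((1/2) *\<^sub>C (x - \<i> *\<^sub>C x'), (1/2) *\<^sub>C (x' - \<i> *\<^sub>C (- x))) \<in> adjoint A"
    by (intro csubspace_PairD_scale csubspace_PairD_diff csubspace_adjoint x x_rot)
  also have "(1/2) *\<^sub>C (x' - \<i> *\<^sub>C (- x)) = \<i> *\<^sub>C n"
    by (simp add: n_def scaleC.diff_right scaleC_add_right scaleC.minus_right scaleC.minus_left scaleC_scaleC)
  finally have n: "n \<in> defect_space A \<i>"
    by (simp add: defect_space_def n_def)
  have "((1/2) *\<^sub>C (x + \<i> *\<^sub>C x'), (1/2) *\<^sub>C (x' + \<i> *\<^sub>C (- x))) \<in> adjoint A"
    by (intro csubspace_PairD_scale csubspace_PairD_add csubspace_adjoint x x_rot)
  also have "(1/2) *\<^sub>C (x' + \<i> *\<^sub>C (- x)) = (- \<i>) *\<^sub>C m"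
    by (simp add: m_def scaleC.diff_right scaleC_add_right scaleC.minus_right scaleC.minus_left scaleC_scaleC)
  finally have m: "m \<in> defect_space A (- \<i>)"
    by (simp add: defect_space_def m_def)
  have half: "(1/2) *\<^sub>C y + (1/2) *\<^sub>C y = y" for y :: 'a
    by (simp add: complex_vector.scale_one flip: scaleC_add_left)
  have "n + m = (1/2) *\<^sub>C x + (1/2) *\<^sub>C x" "\<i> *\<^sub>C n - \<i> *\<^sub>C m = (1/2) *\<^sub>C x' + (1/2) *\<^sub>C x'"
    by (simp_all add: n_def m_def scaleC.diff_right scaleC_add_right scaleC_scaleC scaleC.minus_left)
  then have "n + m = x" "\<i> *\<^sub>C n - \<i> *\<^sub>C m = x'"
    by (simp_all only: half)
  then have "(f - n - m, f' - \<i> *\<^sub>C n + \<i> *\<^sub>C m) = (a, a')"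
    by (simp add: x_def x'_def algebra_simps)
  with a n m show thesis
    using that by metis
qed

text \<open>Gives uniqueness in von Neumann's decomposition. On pairing with \<open>n\<close> and
  with \<open>m\<close> the mixed terms cancel, and only multiples of \<open>(n, n)\<close> and
  \<open>(m, m)\<close> remain.\<close>

lemma defect_space_sum_in_operator:
  assumes A: "symmetric_operator A"
    and n: "n \<in> defect_space A \<i>" and m: "m \<in> defect_space A (- \<i>)"
    and nm: "(n + m, \<i> *\<^sub>C n - \<i> *\<^sub>C m) \<in> A"
  shows "n = 0" "m = 0"
proof -
  have "cinner (\<i> *\<^sub>C n - \<i> *\<^sub>C m) n = cinner (n + m) (\<i> *\<^sub>C n)"
    "cinner (\<i> *\<^sub>C n - \<i> *\<^sub>C m) m = cinner (n + m) ((- \<i>) *\<^sub>C m)"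
    using n m nm by (auto simp: defect_space_def adjoint_iff)
  then have "cinner n n = 0 \<and> cinner m m = 0"
    unfolding cinner_simps by (simp add: algebra_simps)
  then show "n = 0" "m = 0"
    by simp_all
qed

lemma closure_cspan_orthonormal_basis:
  assumes "orthonormal_basis_of L B" "csubspace L" "closed L"
  shows "closure (cspan B) = L"
  using assms unfolding orthonormal_basis_of_def
  by (intro equalityI closure_minimal complex_vector.span_minimal) auto

text \<open>A bijection between orthonormal bases preserves all inner products of basis vectors, so
  it extends to the closed spans, which are the two spaces.\<close>

lemma equal_hilbert_dim_isometry:
  fixes L :: "'a::complex_hilbert set" and K :: "'b::complex_hilbert set"
  assumes "equal_hilbert_dim L K" and L: "csubspace L" "closed L" and K: "csubspace K" "closed K"
  obtains W where "clinear_on K W" "W ` K = L"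
    "\<And>x y. x \<in> K \<Longrightarrow> y \<in> K \<Longrightarrow> cinner (W x) (W y) = cinner x y"
proof -
  obtain B C b where B: "orthonormal_basis_of L B" and C: "orthonormal_basis_of K C"
    and b: "bij_betw b B C"
    using assms(1) unfolding equal_hilbert_dim_def eqpoll_def by blast
  define S where "S = (\<lambda>x. (b x, x)) ` B"
  have delta_B: "cinner x y = (if x = y then 1 else 0)" if "x \<in> B" "y \<in> B" for x y
    using B that by (auto simp: orthonormal_basis_of_def pairwise_def)
  have delta_C: "cinner x y = (if x = y then 1 else 0)" if "x \<in> C" "y \<in> C" for x y
    using C that by (auto simp: orthonormal_basis_of_def pairwise_def)
  have "b x \<in> C" if "x \<in> B" for x
    using b that by (auto simp: bij_betw_def)
  then have gram: "cinner x x' = cinner y y'" if "(x, y) \<in> S" "(x', y') \<in> S" for x y x' y'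
    using that inj_onD [OF bij_betw_imp_inj_on [OF b]] by (auto simp: S_def delta_B delta_C)
  have "Domain S = C" "Range S = B"
    using b by (auto simp: S_def bij_betw_def)
  then have "closure (cspan (Domain S)) = K" "closure (cspan (Range S)) = L"
    using closure_cspan_orthonormal_basis B C L K by metis+
  then show thesis
    using isometric_extension [of S, OF gram] that by metis
qed

text \<open>
  In the von Neumann decomposition \<open>f = a + n + m\<close> with \<open>a \<in> dom A\<close>, \<open>n \<in> ker (A\<^sup>* - \<i>)\<close> and
  \<open>m \<in> ker (A\<^sup>* + \<i>)\<close>, the boundary form equals \<open>2\<i> ((n, n) - (m, m))\<close>. Given an isometry \<open>W\<close>
  from \<open>ker (A\<^sup>* + \<i>)\<close> onto \<open>ker (A\<^sup>* - \<i>)\<close>, the boundary maps are \<open>n + W m\<close> and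
  \<open>\<i> (n - W m)\<close>.
\<close>

theorem boundary_triplet_exists:
  fixes A :: "('a::complex_hilbert, 'a) operator"
  assumes A: "symmetric_operator A" "closed A" and dense: "densely_defined A"
    and "equal_deficiency_indices A"
  obtains \<Gamma>\<^sub>0 \<Gamma>\<^sub>1 :: "'a \<Rightarrow> 'a" where "boundary_triplet A (defect_space A \<i>) \<Gamma>\<^sub>0 \<Gamma>\<^sub>1"
proof -
  note sub = symmetric_operatorD(1) [OF A(1)]
  define N M where "N = defect_space A \<i>" and "M = defect_space A (- \<i>)"
  have N: "csubspace N" "closed N" and M: "csubspace M" "closed M"
    by (simp_all add: N_def M_def csubspace_defect_space closed_defect_space)
  obtain W where W: "clinear_on M W" "W ` M = N"
      "\<And>x y. x \<in> M \<Longrightarrow> y \<in> M \<Longrightarrow> cinner (W x) (W y) = cinner x y"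
    using equal_hilbert_dim_isometry [OF _ N M] assms(4)
    unfolding equal_deficiency_indices_def N_def M_def by metis
  have W_in: "W x \<in> N" if "x \<in> M" for x
    using W(2) that by blast
  have N_adj: "(x, \<i> *\<^sub>C x) \<in> adjoint A" if "x \<in> N" for x
    using that by (simp add: N_def defect_space_def)
  have M_adj: "(x, - \<i> *\<^sub>C x) \<in> adjoint A" if "x \<in> M" for x
    using that by (simp add: M_def defect_space_def)
  \<comment> \<open>With the quantifier over \<open>f'\<close> inside, \<open>n\<close> and
    \<open>m\<close> can be chosen as functions of \<open>f\<close> alone; this rests on the adjoint
    being single-valued. Outside its domain any values serve, here 0.\<close>
  have "\<exists>n m. n \<in> N \<and> m \<in> M \<and>
      (\<forall>f'. (f, f') \<in> adjoint A \<longrightarrow> (f - n - m, f' - \<i> *\<^sub>C n + \<i> *\<^sub>C m) \<in> A)" for f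
  proof (cases "f \<in> Domain (adjoint A)")
    case True
    then obtain f' where f: "(f, f') \<in> adjoint A"
      by blast
    obtain n m where nm: "n \<in> N" "m \<in> M" "(f - n - m, f' - \<i> *\<^sub>C n + \<i> *\<^sub>C m) \<in> A"
      unfolding N_def M_def by (rule von_Neumann_decomposition [OF A f])
    moreover have "f'' = f'" if "(f, f'') \<in> adjoint A" for f''
      using single_valued_adjoint [OF dense] f that by (auto dest: single_valuedD)
    ultimately show ?thesis
      by metis
  next
    case False
    then show ?thesis
      using complex_vector.subspace_0 [OF N(1)] complex_vector.subspace_0 [OF M(1)] by blast
  qed
  then obtain n m where nm: "\<And>f. n f \<in> N" "\<And>f. m f \<in> M"
    and A_part: "\<And>f f'. (f, f') \<in> adjoint A \<Longrightarrow>
      (f - n f - m f, f' - \<i> *\<^sub>C n f + \<i> *\<^sub>C m f) \<in> A"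
    by metis
  \<comment> \<open>Two decompositions of \<open>f\<close> differ by a sum of defect vectors lying
    in \<open>A\<close>, which must be zero. Linearity of \<open>n\<close> and \<open>m\<close> and
    their values on explicit vectors all follow from this.\<close>
  have unique: "n f = x \<and> m f = y"
    if "(f, f') \<in> adjoint A" "x \<in> N" "y \<in> M" "(f - x - y, f' - \<i> *\<^sub>C x + \<i> *\<^sub>C y) \<in> A" for f f' x y
  proof -
    have "((f - n f - m f) - (f - x - y),
        (f' - \<i> *\<^sub>C n f + \<i> *\<^sub>C m f) - (f' - \<i> *\<^sub>C x + \<i> *\<^sub>C y)) \<in> A"
      by (rule csubspace_PairD_diff [OF sub A_part [OF that(1)] that(4)])
    then have "((x - n f) + (y - m f), \<i> *\<^sub>C (x - n f) - \<i> *\<^sub>C (y - m f)) \<in> A"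
      by (simp add: scaleC.diff_right algebra_simps)
    moreover have "x - n f \<in> N" "y - m f \<in> M"
      by (rule csubspace_diff [OF N(1) that(2) nm(1)], rule csubspace_diff [OF M(1) that(3) nm(2)])
    ultimately have "x - n f = 0" "y - m f = 0"
      using defect_space_sum_in_operator [OF A(1)] unfolding N_def M_def by metis+
    then show ?thesis
      by simp
  qed
  have add: "n (f + g) = n f + n g \<and> m (f + g) = m f + m g"
    if dom: "f \<in> Domain (adjoint A)" "g \<in> Domain (adjoint A)" for f g
  proof -
    obtain f' g' where f: "(f, f') \<in> adjoint A" and g: "(g, g') \<in> adjoint A"
      using dom by blast
    have "(f + g, f' + g') \<in> adjoint A"
      by (rule csubspace_PairD_add [OF csubspace_adjoint f g])
    then show ?thesis
    proof (rule unique)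
      show "n f + n g \<in> N" "m f + m g \<in> M"
        using nm N(1) M(1) by (simp_all add: complex_vector.subspace_add)
      show "(f + g - (n f + n g) - (m f + m g),
          f' + g' - \<i> *\<^sub>C (n f + n g) + \<i> *\<^sub>C (m f + m g)) \<in> A"
        using csubspace_PairD_add [OF sub A_part [OF f] A_part [OF g]]
        by (simp add: scaleC_add_right algebra_simps)
    qed
  qed
  have scale: "n (c *\<^sub>C f) = c *\<^sub>C n f \<and> m (c *\<^sub>C f) = c *\<^sub>C m f" if dom: "f \<in> Domain (adjoint A)" for c f
  proof -
    obtain f' where f: "(f, f') \<in> adjoint A"
      using dom by blast
    have "(c *\<^sub>C f, c *\<^sub>C f') \<in> adjoint A"
      by (rule csubspace_PairD_scale [OF csubspace_adjoint f])
    then show ?thesis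
    proof (rule unique)
      show "c *\<^sub>C n f \<in> N" "c *\<^sub>C m f \<in> M"
        using nm N(1) M(1) by (simp_all add: complex_vector.subspace_scale)
      show "(c *\<^sub>C f - c *\<^sub>C n f - c *\<^sub>C m f, c *\<^sub>C f' - \<i> *\<^sub>C c *\<^sub>C n f + \<i> *\<^sub>C c *\<^sub>C m f) \<in> A"
        using csubspace_PairD_scale [OF sub A_part [OF f], of c]
        by (simp add: scaleC_add_right scaleC.diff_right scaleC_scaleC mult.commute)
    qed
  qed
  have green: "cinner f' g - cinner f g' =
      2 * \<i> * (cinner (n f) (n g) - cinner (m f) (m g))"
    if f: "(f, f') \<in> adjoint A" and g: "(g, g') \<in> adjoint A" for f f' g g'
  proof -
    \<comment> \<open>\<open>x\<close> and \<open>y\<close> collect the defect parts;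
      \<open>f - x\<close> and \<open>g - y\<close> lie in the domain of \<open>A\<close> and drop
      out of the boundary form one after the other.\<close>
    define x x' y y' where "x = n f + m f" and "x' = \<i> *\<^sub>C n f - \<i> *\<^sub>C m f"
      and "y = n g + m g" and "y' = \<i> *\<^sub>C n g - \<i> *\<^sub>C m g"
    have "(x, x') \<in> adjoint A"
      using csubspace_PairD_add [OF csubspace_adjoint N_adj [OF nm(1)] M_adj [OF nm(2)]]
      by (simp add: x_def x'_def scaleC.minus_left)
    moreover have "(f - x, f' - x') \<in> A" "(g - y, g' - y') \<in> A"
      using A_part [OF f] A_part [OF g]
      by (simp_all add: x_def x'_def y_def y'_def algebra_simps)
    ultimately have "cinner (f' - x') g = cinner (f - x) g'"
      and "cinner (g' - y') x = cinner (g - y) x'"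
      using g by (auto simp: adjoint_iff)
    moreover from this(2) have "cinner x (g' - y') = cinner x' (g - y)"
      by (metis cinner_commute)
    ultimately have "cinner f' g - cinner f g' = cinner x' g - cinner x g'"
      and "cinner x' g - cinner x g' = cinner x' y - cinner x y'"
      unfolding cinner.diff_left cinner.diff_right by (simp_all add: algebra_simps)
    then have "cinner f' g - cinner f g' = cinner x' y - cinner x y'"
      by (rule trans)
    also have "\<dots> = 2 * \<i> * (cinner (n f) (n g) - cinner (m f) (m g))"
      by (simp add: x_def x'_def y_def y'_def cinner_simps algebra_simps)
    finally show ?thesis .
  qed
  define \<Gamma>\<^sub>0 \<Gamma>\<^sub>1 where "\<Gamma>\<^sub>0 = (\<lambda>f. n f + W (m f))" and "\<Gamma>\<^sub>1 = (\<lambda>f. \<i> *\<^sub>C (n f - W (m f)))"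
  have "boundary_triplet A N \<Gamma>\<^sub>0 \<Gamma>\<^sub>1"
    unfolding boundary_triplet_def
  proof (intro conjI)
    show "csubspace N" "closed N"
      by (fact N)+
    show "clinear_on (Domain (adjoint A)) \<Gamma>\<^sub>0" "clinear_on (Domain (adjoint A)) \<Gamma>\<^sub>1"
      by (simp_all add: clinear_on_def \<Gamma>\<^sub>0_def \<Gamma>\<^sub>1_def add scale clinear_onD [OF W(1)] nm
          scaleC_add_right scaleC.diff_right scaleC_scaleC mult.commute)
    show "\<forall>(f, f')\<in>adjoint A. \<forall>(g, g')\<in>adjoint A. cinner f' g - cinner f g' =
        cinner (\<Gamma>\<^sub>1 f) (\<Gamma>\<^sub>0 g) - cinner (\<Gamma>\<^sub>0 f) (\<Gamma>\<^sub>1 g)"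
    proof clarify
      fix f f' g g'
      assume "(f, f') \<in> adjoint A" "(g, g') \<in> adjoint A"
      then show "cinner f' g - cinner f g' = cinner (\<Gamma>\<^sub>1 f) (\<Gamma>\<^sub>0 g) - cinner (\<Gamma>\<^sub>0 f) (\<Gamma>\<^sub>1 g)"
        by (simp add: green W(3) [OF nm(2) nm(2), symmetric] \<Gamma>\<^sub>0_def \<Gamma>\<^sub>1_def cinner_simps algebra_simps)
    qed
    show "(\<lambda>f. (\<Gamma>\<^sub>1 f, \<Gamma>\<^sub>0 f)) ` Domain (adjoint A) = N \<times> N"
    proof (intro equalityI subsetI)
      fix p
      assume "p \<in> N \<times> N"
      then obtain k h where p: "p = (k, h)" and kh: "k \<in> N" "h \<in> N"
        by blast
      \<comment> \<open>The solution of \<open>x + w = h\<close> and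
        \<open>\<i> *\<^sub>C (x - w) = k\<close>; with \<open>W y = w\<close>, the vector
        \<open>x + y\<close> then has the prescribed boundary values.\<close>
      define x w where "x = (1/2) *\<^sub>C (h - \<i> *\<^sub>C k)" and "w = (1/2) *\<^sub>C (h + \<i> *\<^sub>C k)"
      have xw: "x \<in> N" "w \<in> N"
        using kh N(1) by (simp_all add: x_def w_def csubspace_diff complex_vector.subspace_add
            complex_vector.subspace_scale)
      then obtain y where y: "y \<in> M" "W y = w"
        using W(2) by auto
      have xy: "(x + y, \<i> *\<^sub>C x - \<i> *\<^sub>C y) \<in> adjoint A"
        using csubspace_PairD_add [OF csubspace_adjoint N_adj [OF xw(1)] M_adj [OF y(1)]]
        by (simp add: scaleC.minus_left)
      then have "n (x + y) = x \<and> m (x + y) = y"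
        by (rule unique) (use xw y csubspace_PairD_0 [OF sub] in auto)
      moreover have half: "(1/2) *\<^sub>C v + (1/2) *\<^sub>C v = v" for v :: 'a
        by (simp add: complex_vector.scale_one flip: scaleC_add_left)
      have "x + w = (1/2) *\<^sub>C h + (1/2) *\<^sub>C h" "\<i> *\<^sub>C (x - w) = (1/2) *\<^sub>C k + (1/2) *\<^sub>C k"
        by (simp_all add: x_def w_def scaleC.diff_right scaleC_add_right scaleC_scaleC scaleC.minus_left)
      then have "x + w = h" "\<i> *\<^sub>C (x - w) = k"
        by (simp_all only: half)
      ultimately have "p = (\<Gamma>\<^sub>1 (x + y), \<Gamma>\<^sub>0 (x + y))"
        by (simp add: p \<Gamma>\<^sub>0_def \<Gamma>\<^sub>1_def y(2))
      then show "p \<in> (\<lambda>f. (\<Gamma>\<^sub>1 f, \<Gamma>\<^sub>0 f)) ` Domain (adjoint A)"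
        using xy by blast
    qed (auto simp: \<Gamma>\<^sub>0_def \<Gamma>\<^sub>1_def nm W_in N(1) csubspace_diff complex_vector.subspace_add
        complex_vector.subspace_scale)
  qed
  then show thesis
    using that by (simp add: N_def)
qed

theorem corollary3p10:
  fixes A :: "('a::complex_hilbert, 'a) operator"
    and B :: "('b::complex_hilbert, 'b) operator"
  assumes "separable_space (euclidean :: 'a topology)"
    and "separable_space (euclidean :: 'b topology)"
    and "symmetric_operator A" "closed A" "densely_defined A"
    and "simple_operator A" "equal_deficiency_indices A"
    and "symmetric_operator B" "closed B" "densely_defined B"
    and "simple_operator B" "equal_deficiency_indices B"
  shows "(unitarily_equivalent A B \<longleftrightarrow>
      (\<exists>(H :: 'a set) \<Gamma>\<^sub>0 \<Gamma>\<^sub>1 \<Delta>\<^sub>0 \<Delta>\<^sub>1. triplets_with_same_weyl_function A B H \<Gamma>\<^sub>0 \<Gamma>\<^sub>1 \<Delta>\<^sub>0 \<Delta>\<^sub>1)) \<and>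
    (\<forall>(H :: 'h::complex_hilbert set) \<Gamma>\<^sub>0 \<Gamma>\<^sub>1 \<Delta>\<^sub>0 \<Delta>\<^sub>1.
      triplets_with_same_weyl_function A B H \<Gamma>\<^sub>0 \<Gamma>\<^sub>1 \<Delta>\<^sub>0 \<Delta>\<^sub>1 \<longrightarrow>
        unitarily_equivalent A B \<and>
        unitarily_equivalent (kernel_extension A \<Gamma>\<^sub>0) (kernel_extension B \<Delta>\<^sub>0))"
proof -
  note A = assms(3-7) and B = assms(8-12)
  \<comment> \<open>The type \<open>'h\<close> is fixed within the proof, so boundary spaces inside
    the space of \<open>A\<close> require a separate instance.\<close>
  have "unitarily_equivalent A B"
    if "triplets_with_same_weyl_function A B H \<Gamma>\<^sub>0 \<Gamma>\<^sub>1 \<Delta>\<^sub>0 \<Delta>\<^sub>1" for H :: "'a set" and \<Gamma>\<^sub>0 \<Gamma>\<^sub>1 \<Delta>\<^sub>0 \<Delta>\<^sub>1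
    using that A B
    by (intro same_weyl_function_unitarily_equivalent(1) [of A H \<Gamma>\<^sub>0 \<Gamma>\<^sub>1 B \<Delta>\<^sub>0 \<Delta>\<^sub>1])
      (auto simp: triplets_with_same_weyl_function_def boundary_triplet_operator_def)
  moreover have "unitarily_equivalent A B \<and>
      unitarily_equivalent (kernel_extension A \<Gamma>\<^sub>0) (kernel_extension B \<Delta>\<^sub>0)"
    if "triplets_with_same_weyl_function A B H \<Gamma>\<^sub>0 \<Gamma>\<^sub>1 \<Delta>\<^sub>0 \<Delta>\<^sub>1" for H :: "'h set" and \<Gamma>\<^sub>0 \<Gamma>\<^sub>1 \<Delta>\<^sub>0 \<Delta>\<^sub>1
    using that A B
    by (intro conjI same_weyl_function_unitarily_equivalent [of A H \<Gamma>\<^sub>0 \<Gamma>\<^sub>1 B \<Delta>\<^sub>0 \<Delta>\<^sub>1])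
      (auto simp: triplets_with_same_weyl_function_def boundary_triplet_operator_def)
  \<comment> \<open>The witness for \<open>H\<close> is \<open>defect_space A \<i>\<close>; the
    triplet for \<open>B\<close> is the one for \<open>A\<close> moved by the unitary
    operator.\<close>
  moreover have "\<exists>(H :: 'a set) \<Gamma>\<^sub>0 \<Gamma>\<^sub>1 \<Delta>\<^sub>0 \<Delta>\<^sub>1. triplets_with_same_weyl_function A B H \<Gamma>\<^sub>0 \<Gamma>\<^sub>1 \<Delta>\<^sub>0 \<Delta>\<^sub>1"
    if "unitarily_equivalent A B"
    using that boundary_triplet_unitary_transfer boundary_triplet_exists [OF A(1-3,5)]
    unfolding unitarily_equivalent_def by metis
  ultimately show ?thesis
    by blast
qed

end
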